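(* Let $\Lambda$ be a finite nonempty set, fix $\delta > 0$ and $r \in \mathbb{Z}_{>0}$. Then for arbitrarily large $N \in \mathbb{Z}_{>0}$ the following holds: whenever $A \subset T_N \times T_N$ satisfies $d_N(A) \geq \delta$, there exist a positive integer $q$ and a mapping $\phi: T_r \times \{0,1,\ldots,r\} \to A$ such that (1) for some constants $c_1,c_2\in\mathbb{Z}_{\ge 0}$ we have $\operatorname{Level}(\phi(u,j)) = (q|u|+c_1,\, qj+c_2)$ for all $u \in T_r$, $j\in\{0,1,\ldots,r\}$; (2) for each $j \in \{0,1,\ldots,r\}$ there are a regular embedding $\phi_j : T_r \to T_N$ which is arithmetic with gap $q$, and $y_j \in T_N$, such that $\phi(u,j) = (\phi_j(u), y_j)$ for all $u \in T_r$.
   Context: $\Lambda^*$ is the free monoid of finite words over $\Lambda$, $|w|$ the length of $w$, $T_N = \{w\in\Lambda^*: |w|\le N\}$, $L_i = \{w \in \Lambda^*: |w| = i\}$. For $(x,y)\in\Lambda^*\times\Lambda^*$, $\operatorname{Level}(x,y) = (|x|,|y|)$. For $A \subset T_N\times T_N$, $d_N(A) = \frac{1}{N^2}\sum_{0\le i,j\le N-1}\frac{|A\cap(L_i\times L_j)|}{|L_i\times L_j|}$. A word $w'$ is a descendent of $w$ if $w'=wu$ for some $u\in\Lambda^*$. A regular embedding $\phi: T_d \to T_N$ is an injective map such that (i) $|w|=|w'|$ implies $|\phi(w)|=|\phi(w')|$, and (ii) for $w\in T_{d-1}$, $\lambda\in\Lambda$, $\phi(w\lambda)$ is a descendent of $\phi(w)\lambda$.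 It is arithmetic with gap $q$ if moreover $|\phi(w\lambda)| = |\phi(w)|+q$ for all $w\in T_{d-1}$, $\lambda\in\Lambda$. *)

theory Defs
  imports Complex_Main "HOL-Library.FuncSet"
begin

text \<open>Words over the alphabet \<open>\<Lambda>\<close> are the lists in \<^term>\<open>lists \<Lambda>\<close>.\<close>

definition tree :: "'a set \<Rightarrow> nat \<Rightarrow> 'a list set" where
  "tree \<Lambda> N = {w \<in> lists \<Lambda>. length w \<le> N}"

definition layer :: "'a set \<Rightarrow> nat \<Rightarrow> 'a list set" where
  "layer \<Lambda> i = {w \<in> lists \<Lambda>. length w = i}"

definition Level :: "'a list \<times> 'a list \<Rightarrow> nat \<times> nat" where
  "Level p = (length (fst p), length (snd p))"

definition density :: "'a set \<Rightarrow> nat \<Rightarrow> ('a list \<times> 'a list) set \<Rightarrow> real" where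
  "density \<Lambda> N A =
     1 / (real N)\<^sup>2 *
     (\<Sum>i<N. \<Sum>j<N. real (card (A \<inter> (layer \<Lambda> i \<times> layer \<Lambda> j))) /
                     real (card (layer \<Lambda> i \<times> layer \<Lambda> j)))"

definition descendent :: "'a set \<Rightarrow> 'a list \<Rightarrow> 'a list \<Rightarrow> bool" where
  "descendent \<Lambda> w' w \<longleftrightarrow> (\<exists>u \<in> lists \<Lambda>. w' = w @ u)"

text \<open>An embedding is a total function of which only the values on \<^term>\<open>tree \<Lambda> d\<close> matter.
  The words of length less than \<open>d\<close> form the tree of height \<open>d - 1\<close>, which is empty for
  \<open>d = 0\<close>; truncated subtraction would instead give the tree of height \<open>0\<close>.\<close>

definition regular_embedding ::
    "'a set \<Rightarrow> nat \<Rightarrow> nat \<Rightarrow> ('a list \<Rightarrow> 'a list) \<Rightarrow> bool" where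
  "regular_embedding \<Lambda> d N \<phi> \<longleftrightarrow>
     \<phi> \<in> tree \<Lambda> d \<rightarrow> tree \<Lambda> N \<and>
     inj_on \<phi> (tree \<Lambda> d) \<and>
     (\<forall>w \<in> tree \<Lambda> d. \<forall>w' \<in> tree \<Lambda> d.
        length w = length w' \<longrightarrow> length (\<phi> w) = length (\<phi> w')) \<and>
     (\<forall>w \<in> lists \<Lambda>. \<forall>a \<in> \<Lambda>. length w < d \<longrightarrow>
        descendent \<Lambda> (\<phi> (w @ [a])) (\<phi> w @ [a]))"

definition arithmetic_embedding ::
    "'a set \<Rightarrow> nat \<Rightarrow> nat \<Rightarrow> nat \<Rightarrow> ('a list \<Rightarrow> 'a list) \<Rightarrow> bool" where
  "arithmetic_embedding \<Lambda> d N q \<phi> \<longleftrightarrow>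
     regular_embedding \<Lambda> d N \<phi> \<and>
     (\<forall>w \<in> lists \<Lambda>. \<forall>a \<in> \<Lambda>. length w < d \<longrightarrow>
        length (\<phi> (w @ [a])) = length (\<phi> w) + q)"

end

(* Trees are reduced to sets of levels. Let F(S) be the family of level sets of the regularly
   embedded trees with all nodes in S. Splitting at the root gives |F(S)| >= b^d for a constant
   b > 1, where d is the sum over the levels of the density of S in that level; so F(S) has
   exponentially many members, hence a member containing a positive proportion of all levels.
   (This is the argument of Pach, Solymosi and Tardos.) Applied to the sections of A at suitably
   chosen words y_j in the second coordinate, one for each level j, it produces a dense set of
   pairs of levels, and any homothetic copy of the square grid {0..r} x {0..r} in that set yields
   the required embeddings.

   Such a grid exists by the two-dimensional theorem of Szemeredi, which follows from the density
   Hales-Jewett theorem for an alphabet of (r+1)^2 letters. The latter is proved by induction on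
   the alphabet and density increment, along the lines of Polymath and of Dodos, Kanellopoulos and
   Tyros. *)

theory Submission
  imports Defs
begin

section \<open>Words and combinatorial subspaces\<close>

text \<open>The trees for different j may be unrelated: all u share the word y_j, and only the
  levels have to match. So for each j it suffices to remember the set H_j of levels of one regular
  tree in the section at y_j, because such a tree can be thinned to any arithmetic progression of
  its levels. A large H_j is found by counting, as few subsets of {..<N} are small; no tree is built
  level by level.

  In the density increment, the usual partition of an insensitive set into subspaces appears only in
  dual form: a function h \<le> 1 with nonpositive sum over every d-dimensional subspace has sum at
  most \<beta> (k+1)^n over every intersection of insensitive sets. It is applied to h = (indicator
  of a section of A) - (c + \<gamma>), where c is the critical density and d a dimension in which
  line-free sets have density below c + \<gamma>. Passing from one insensitive set to k of them is
  then a mere change of h. The colouring theorems serve to make one property of lines independent of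
  M free coordinates.\<close>

definition words :: "nat \<Rightarrow> nat \<Rightarrow> nat list set" where
  "words k n = {w. set w \<subseteq> {..<k} \<and> length w = n}"

lemma finite_words [simp]: "finite (words k n)"
  unfolding words_def by (rule finite_lists_length_eq) simp

lemma card_words [simp]: "card (words k n) = k ^ n"
  unfolding words_def by (subst card_lists_length_eq) simp_all

lemma length_words: "w \<in> words k n \<Longrightarrow> length w = n"
  by (simp add: words_def)

lemma words_0 [simp]: "words k 0 = {[]}"
  by (auto simp: words_def)

lemma Cons_in_words [simp]: "a # w \<in> words k (Suc n) \<longleftrightarrow> a < k \<and> w \<in> words k n"
  by (auto simp: words_def)

lemma append_in_words: "x \<in> words k m \<Longrightarrow> y \<in> words k n \<Longrightarrow> x @ y \<in> words k (m + n)"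
  by (auto simp: words_def)

lemma replicate_in_words: "a < k \<Longrightarrow> replicate n a \<in> words k n"
  by (auto simp: words_def)

lemma words_mono: "k \<le> l \<Longrightarrow> words k n \<subseteq> words l n"
  by (auto simp: words_def)

lemma words_append_split:
  assumes "w \<in> words k (m + n)"
  obtains x y where "x \<in> words k m" "y \<in> words k n" "w = x @ y"
proof (rule that[of "take m w" "drop m w"])
  show "take m w \<in> words k m" "drop m w \<in> words k n"
    using assms by (auto simp: words_def dest: in_set_takeD in_set_dropD)
qed simp

lemma sum_words_append:
  fixes f :: "nat list \<Rightarrow> 'b :: comm_monoid_add"
  shows "(\<Sum>w\<in>words k (m + n). f w) = (\<Sum>x\<in>words k m. \<Sum>y\<in>words k n. f (x @ y))"
proof -
  have "(\<Sum>x\<in>words k m. \<Sum>y\<in>words k n. f (x @ y))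
      = (\<Sum>(x, y)\<in>words k m \<times> words k n. f (x @ y))"
    by (simp add: sum.cartesian_product)
  also have "\<dots> = (\<Sum>w\<in>words k (m + n). f w)"
    by (rule sum.reindex_bij_witness[where i = "\<lambda>w. (take m w, drop m w)" and j = "\<lambda>(x, y). x @ y"])
       (auto simp: words_def dest: in_set_takeD in_set_dropD)
  finally show ?thesis by simp
qed

lemma sum_words_1:
  fixes f :: "nat list \<Rightarrow> 'b :: comm_monoid_add"
  shows "(\<Sum>w\<in>words k 1. f w) = (\<Sum>a<k. f [a])"
  by (rule sum.reindex_bij_witness[where i = "\<lambda>a. [a]" and j = hd])
     (auto simp: words_def length_Suc_conv)

lemma sum_words_Suc:
  fixes f :: "nat list \<Rightarrow> 'b :: comm_monoid_add"
  shows "(\<Sum>w\<in>words k (Suc n). f w) = (\<Sum>a<k. \<Sum>x\<in>words k n. f (a # x))"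
  using sum_words_append[of f k 1 n] sum_words_1[of "\<lambda>z. \<Sum>y\<in>words k n. f (z @ y)" k] by simp

lemma real_card_eq_sum:
  "finite S \<Longrightarrow> real (card {x \<in> S. P x}) = (\<Sum>x\<in>S. of_bool (P x))"
  by (simp add: of_bool_def sum.If_cases Int_def)

text \<open>A combinatorial subspace of dimension \<open>d\<close> is a word in letters \<open>Inl a\<close> and variables
  \<open>Inr j\<close>, \<open>j < d\<close>, in which every variable occurs.\<close>

definition subspaces :: "nat \<Rightarrow> nat \<Rightarrow> nat \<Rightarrow> (nat + nat) list set" where
  "subspaces k d n = {u. length u = n \<and> (\<forall>a. Inl a \<in> set u \<longrightarrow> a < k) \<and>
     (\<forall>j. Inr j \<in> set u \<longleftrightarrow> j < d)}"

definition plug :: "(nat + nat) list \<Rightarrow> nat list \<Rightarrow> nat list" where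
  "plug u x = map (case_sum id (nth x)) u"

definition compose_sub :: "(nat + nat) list \<Rightarrow> (nat + nat) list \<Rightarrow> (nat + nat) list" where
  "compose_sub u v = map (case_sum Inl (nth v)) u"

definition join_sub :: "nat \<Rightarrow> (nat + nat) list \<Rightarrow> (nat + nat) list \<Rightarrow> (nat + nat) list" where
  "join_sub d u v = u @ map (map_sum id ((+) d)) v"

lemma length_subspaces: "u \<in> subspaces k d n \<Longrightarrow> length u = n"
  by (simp add: subspaces_def)

lemma length_plug [simp]: "length (plug u x) = length u"
  by (simp add: plug_def)

lemma finite_subspaces: "finite (subspaces k d n)"
proof (rule finite_subset)
  show "subspaces k d n \<subseteq> {u. set u \<subseteq> Inl ` {..<k} \<union> Inr ` {..<d} \<and> length u = n}"
  proof
    fix u assume u: "u \<in> subspaces k d n"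
    have "t \<in> Inl ` {..<k} \<union> Inr ` {..<d}" if "t \<in> set u" for t
      using u that by (cases t) (auto simp: subspaces_def)
    then show "u \<in> {u. set u \<subseteq> Inl ` {..<k} \<union> Inr ` {..<d} \<and> length u = n}"
      using u by (auto simp: subspaces_def)
  qed
qed (rule finite_lists_length_eq, simp)

lemma subspaces_mono: "k \<le> l \<Longrightarrow> subspaces k d n \<subseteq> subspaces l d n"
  unfolding subspaces_def by (auto intro: less_le_trans)

lemma plug_in_words:
  assumes "u \<in> subspaces k d n" "x \<in> words k d"
  shows "plug u x \<in> words k n"
proof -
  have "case_sum id (nth x) t < k" if t: "t \<in> set u" for t
  proof (cases t)
    case (Inr j)
    then have "j < length x" using t assms by (simp add: subspaces_def words_def)
    then have "x ! j \<in> set x" by simp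
    then show ?thesis using Inr assms by (auto simp: words_def)
  qed (use t assms in \<open>auto simp: subspaces_def\<close>)
  then show ?thesis
    using assms by (auto simp: plug_def words_def subspaces_def)
qed

lemma compose_sub_in:
  assumes u: "u \<in> subspaces k d n" and v: "v \<in> subspaces k e d"
  shows "compose_sub u v \<in> subspaces k e n"
proof -
  have *: "case_sum Inl (nth v) t \<in> set v \<or> (\<exists>a<k. case_sum Inl (nth v) t = Inl a)"
    if t: "t \<in> set u" for t
  proof (cases t)
    case (Inr j)
    then show ?thesis using t u v by (simp add: subspaces_def)
  qed (use t u in \<open>auto simp: subspaces_def\<close>)
  have **: "t \<in> set v \<or> (\<exists>a<k. t = Inl a)" if "t \<in> set (compose_sub u v)" for t
    using that * by (auto simp: compose_sub_def)
  have "a < k" if "Inl a \<in> set (compose_sub u v)" for a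
    using **[OF that] v by (auto simp: subspaces_def)
  moreover have "Inr j \<in> set (compose_sub u v) \<longleftrightarrow> j < e" for j
  proof
    assume "Inr j \<in> set (compose_sub u v)"
    from **[OF this] show "j < e" using v by (auto simp: subspaces_def)
  next
    assume "j < e"
    then have "Inr j \<in> set v" using v by (simp add: subspaces_def)
    then obtain i where i: "i < d" "v ! i = Inr j"
      using v by (auto simp: subspaces_def in_set_conv_nth)
    then have "Inr i \<in> set u"
      using u by (simp add: subspaces_def)
    then have "case_sum Inl (nth v) (Inr i) \<in> set (compose_sub u v)"
      unfolding compose_sub_def set_map by (rule imageI)
    then show "Inr j \<in> set (compose_sub u v)"
      using i by simp
  qed
  ultimately show ?thesis
    using u by (simp add: subspaces_def compose_sub_def)
qed

lemma plug_compose_sub: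
  assumes "u \<in> subspaces k d n" "length v = d"
  shows "plug (compose_sub u v) x = plug u (plug v x)"
  using assms by (auto simp: plug_def compose_sub_def subspaces_def split: sum.split)

lemma join_sub_in:
  assumes "u \<in> subspaces k d m" "v \<in> subspaces k e n"
  shows "join_sub d u v \<in> subspaces k (d + e) (m + n)"
proof -
  have l: "Inl a \<in> map_sum id ((+) d) ` set v \<longleftrightarrow> Inl a \<in> set v" for a
  proof -
    have "Inl a = map_sum id ((+) d) t \<longleftrightarrow> t = Inl a" for t :: "nat + nat" by (cases t) auto
    then show ?thesis by (auto simp: image_iff)
  qed
  have r: "Inr j \<in> map_sum id ((+) d) ` set v \<longleftrightarrow> (\<exists>i. j = d + i \<and> Inr i \<in> set v)" for j
  proof -
    have "Inr j = map_sum id ((+) d) t \<longleftrightarrow> (\<exists>i. j = d + i \<and> t = Inr i)" for t :: "nat + nat" by (cases t) auto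
    then show ?thesis by (auto simp: image_iff)
  qed
  have "j < d \<or> (\<exists>i. j = d + i \<and> i < e) \<longleftrightarrow> j < d + e" for j
    by presburger
  then show ?thesis
    using assms by (auto simp: subspaces_def join_sub_def l r)
qed

lemma plug_join_sub:
  assumes "u \<in> subspaces k d m" "length x = d"
  shows "plug (join_sub d u v) (x @ y) = plug u x @ plug v y"
proof -
  have "case_sum id (nth (x @ y)) t = case_sum id (nth x) t" if "t \<in> set u" for t
    using assms that by (cases t) (auto simp: subspaces_def nth_append)
  moreover have "case_sum id (nth (x @ y)) (map_sum id ((+) d) t) = case_sum id (nth y) t" for t
    using assms by (cases t) (auto simp: nth_append)
  ultimately show ?thesis by (simp add: plug_def join_sub_def)
qed

lemma const_in_subspaces: "z \<in> words k m \<Longrightarrow> map Inl z \<in> subspaces k 0 m"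
  by (auto simp: subspaces_def words_def)

lemma plug_const [simp]: "plug (map Inl z) x = z"
  by (simp add: plug_def comp_def)

lemma ident_in_subspaces: "map Inr [0..<d] \<in> subspaces k d d"
  by (auto simp: subspaces_def)

lemma plug_ident: "length x = d \<Longrightarrow> plug (map Inr [0..<d]) x = x"
  by (auto simp: plug_def comp_def intro: nth_equalityI)

lemma subspace_append_const:
  assumes "u \<in> subspaces k d m" "z \<in> words k n"
  obtains v where "v \<in> subspaces k d (m + n)" "\<And>x. length x = d \<Longrightarrow> plug v x = plug u x @ z"
proof (rule that[of "join_sub d u (map Inl z)"])
  show "join_sub d u (map Inl z) \<in> subspaces k d (m + n)"
    using join_sub_in[OF assms(1) const_in_subspaces[OF assms(2)]] by simp
  show "plug (join_sub d u (map Inl z)) x = plug u x @ z" if "length x = d" for x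
    using plug_join_sub[OF assms(1) that, of "map Inl z" "[]"] by simp
qed

lemma subspace_const_append:
  assumes "z \<in> words k m" "u \<in> subspaces k d n"
  obtains v where "v \<in> subspaces k d (m + n)" "\<And>x. plug v x = z @ plug u x"
proof (rule that[of "join_sub 0 (map Inl z) u"])
  show "join_sub 0 (map Inl z) u \<in> subspaces k d (m + n)"
    using join_sub_in[OF const_in_subspaces[OF assms(1)] assms(2)] by simp
  show "plug (join_sub 0 (map Inl z) u) x = z @ plug u x" for x
    using plug_join_sub[OF const_in_subspaces[OF assms(1)], of "[]" u x] by simp
qed

lemma inj_on_plug:
  assumes "u \<in> subspaces k d n"
  shows "inj_on (plug u) (words l d)"
proof
  fix x y assume *: "x \<in> words l d" "y \<in> words l d" "plug u x = plug u y"
  have "x ! j = y ! j" if "j < d" for j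
  proof -
    have "Inr j \<in> set u" using assms that by (simp add: subspaces_def)
    then show ?thesis using *(3) by (auto simp: plug_def)
  qed
  then show "x = y" using * by (auto simp: words_def intro: nth_equalityI)
qed

section \<open>Substituting a letter for the last letter \<open>k\<close>\<close>

definition rep :: "nat \<Rightarrow> nat \<Rightarrow> nat list \<Rightarrow> nat list" where
  "rep k i w = map (\<lambda>a. if a = k then i else a) w"

lemma length_rep [simp]: "length (rep k i w) = length w"
  by (simp add: rep_def)

lemma rep_append [simp]: "rep k i (x @ y) = rep k i x @ rep k i y"
  by (simp add: rep_def)

lemma rep_self [simp]: "rep k k w = w"
  by (simp add: rep_def map_idI)

lemma rep_idem: "i \<noteq> k \<Longrightarrow> rep k i (rep k i w) = rep k i w"
  by (simp add: rep_def)

lemma rep_in_words: "w \<in> words (Suc k) n \<Longrightarrow> i < k \<Longrightarrow> rep k i w \<in> words k n"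
  by (force simp: rep_def words_def less_Suc_eq)

lemma rep_plug:
  assumes "u \<in> subspaces k d n" "length x = d"
  shows "rep k i (plug u x) = plug u (rep k i x)"
  using assms by (auto simp: plug_def rep_def subspaces_def split: sum.split)

text \<open>In contrast to \<open>rep_plug\<close>, \<open>u\<close> may contain the constant letter
  \<open>k\<close>, which a substitution in \<open>x\<close> does not reach; an outer
  \<open>rep k i\<close> evens this out.\<close>

lemma rep_plug_rep:
  assumes "u \<in> subspaces l d n" "length x = d" "i \<noteq> k"
  shows "rep k i (plug u (rep k i x)) = rep k i (plug u x)"
  using assms by (auto simp: plug_def rep_def subspaces_def split: sum.split)

section \<open>Colouring theorems\<close>

text \<open>Colourings are encoded as finite families \<open>F\<close> of predicates; a set is monochromatic if no
  predicate of \<open>F\<close> distinguishes two of its points. Product colourings are then just families of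
  sections.\<close>

definition unavoidable :: "nat \<Rightarrow> 'u set \<Rightarrow> ((nat list \<Rightarrow> bool) \<Rightarrow> 'u \<Rightarrow> bool) \<Rightarrow> bool" where
  "unavoidable r U Q \<longleftrightarrow> (\<forall>F. finite F \<and> card F \<le> r \<longrightarrow> (\<exists>u\<in>U. \<forall>P\<in>F. Q P u))"

lemma unavoidableI:
  assumes "\<And>F. finite F \<Longrightarrow> card F \<le> r \<Longrightarrow> \<exists>u\<in>U. \<forall>P\<in>F. Q P u"
  shows "unavoidable r U Q"
  using assms by (simp add: unavoidable_def)

lemma unavoidableE:
  assumes "unavoidable r U Q" "finite F" "card F \<le> r"
  obtains u where "u \<in> U" "\<forall>P\<in>F. Q P u"
  using assms by (auto simp: unavoidable_def)

definition constant_on :: "'b set \<Rightarrow> ('b \<Rightarrow> bool) \<Rightarrow> bool" where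
  "constant_on S f \<longleftrightarrow> (\<forall>x\<in>S. \<forall>y\<in>S. f x \<longleftrightarrow> f y)"

lemma constant_onD: "constant_on S f \<Longrightarrow> x \<in> S \<Longrightarrow> y \<in> S \<Longrightarrow> f x \<longleftrightarrow> f y"
  unfolding constant_on_def by blast

lemma constant_onI: "(\<And>x y. x \<in> S \<Longrightarrow> y \<in> S \<Longrightarrow> f x \<longleftrightarrow> f y) \<Longrightarrow> constant_on S f"
  unfolding constant_on_def by blast

definition hales_jewett :: "nat \<Rightarrow> bool" where
  "hales_jewett k \<longleftrightarrow> (\<forall>r. \<exists>m. unavoidable r (subspaces k 1 m)
     (\<lambda>P l. constant_on {..<k} (\<lambda>a. P (plug l [a]))))"

text \<open>Fixing a prefix \<open>z\<close> turns each predicate into at most \<open>K ^ n\<close>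
  predicates, so this is the case of more colours. The prefix may use more letters than the line, as
  colour focusing requires.\<close>

lemma hales_jewett_sections:
  assumes "hales_jewett k"
  shows "\<exists>m. unavoidable r (subspaces k 1 m)
     (\<lambda>P l. \<forall>z \<in> words K n. constant_on {..<k} (\<lambda>a. P (z @ plug l [a])))"
proof -
  obtain m where m: "unavoidable (r * K ^ n) (subspaces k 1 m)
     (\<lambda>P l. constant_on {..<k} (\<lambda>a. P (plug l [a])))"
    using assms[unfolded hales_jewett_def, rule_format, of "r * K ^ n"] ..
  have "unavoidable r (subspaces k 1 m)
     (\<lambda>P l. \<forall>z \<in> words K n. constant_on {..<k} (\<lambda>a. P (z @ plug l [a])))"
  proof (rule unavoidableI)
    fix F :: "(nat list \<Rightarrow> bool) set"
    assume F: "finite F" "card F \<le> r"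
    define G where "G = (\<lambda>(P, z) x. P (z @ x)) ` (F \<times> words K n)"
    have "card G \<le> card (F \<times> words K n)"
      unfolding G_def using F by (intro card_image_le) simp
    also have "\<dots> \<le> r * K ^ n"
      using F by (simp add: card_cartesian_product)
    finally have "card G \<le> r * K ^ n" .
    moreover have "finite G" using F by (simp add: G_def)
    ultimately have G: "finite G" "card G \<le> r * K ^ n" by auto
    obtain l where l1: "l \<in> subspaces k 1 m" and
      "\<forall>P\<in>G. constant_on {..<k} (\<lambda>a. P (plug l [a]))"
      by (rule unavoidableE[OF m G], rule that)
    note l2 = bspec[OF this(2)]
    have "constant_on {..<k} (\<lambda>a. P (z @ plug l [a]))" if "P \<in> F" "z \<in> words K n" for P z
      using l2[of "\<lambda>x. P (z @ x)"] that unfolding G_def by auto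
    with l1 show "\<exists>l \<in> subspaces k 1 m. \<forall>P\<in>F. \<forall>z \<in> words K n.
        constant_on {..<k} (\<lambda>a. P (z @ plug l [a]))" by blast
  qed
  then show ?thesis ..
qed

text \<open>Colour focusing. The line for the last coordinate is chosen first, monochromatic behind
  every prefix in the earlier block; for the earlier block the last coordinate then has just two
  relevant values.\<close>

lemma hales_jewett_focus:
  assumes "hales_jewett k" "k > 0"
  shows "\<exists>m. unavoidable r (subspaces (Suc k) s m)
     (\<lambda>P u. \<forall>p\<le>s. constant_on (words k p) (\<lambda>w. P (plug u (w @ replicate (s - p) k))))"
proof (induction s arbitrary: r)
  case 0
  have "[] \<in> subspaces (Suc k) 0 0" by (simp add: subspaces_def)
  then show ?case
    by (intro exI[of _ 0] unavoidableI bexI[of _ "[]"]) (auto simp: constant_on_def)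
next
  case (Suc s)
  obtain m where m: "unavoidable (2 * r) (subspaces (Suc k) s m)
     (\<lambda>P u. \<forall>p\<le>s. constant_on (words k p) (\<lambda>w. P (plug u (w @ replicate (s - p) k))))"
    using Suc.IH ..
  obtain n where n: "unavoidable r (subspaces k 1 n)
     (\<lambda>P l. \<forall>z \<in> words (Suc k) m. constant_on {..<k} (\<lambda>a. P (z @ plug l [a])))"
    using hales_jewett_sections[OF assms(1)] ..
  have "unavoidable r (subspaces (Suc k) (Suc s) (m + n)) (\<lambda>P v. \<forall>p\<le>Suc s.
      constant_on (words k p) (\<lambda>w. P (plug v (w @ replicate (Suc s - p) k))))"
  proof (rule unavoidableI)
    fix F :: "(nat list \<Rightarrow> bool) set"
    assume F: "finite F" "card F \<le> r"
    obtain l where l: "l \<in> subspaces k 1 n" and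
      "\<forall>P\<in>F. \<forall>z \<in> words (Suc k) m. constant_on {..<k} (\<lambda>a. P (z @ plug l [a]))"
      by (rule unavoidableE[OF n F], rule that)
    note l2 = bspec[OF this(2)]
    have l': "l \<in> subspaces (Suc k) 1 n" using l subspaces_mono[of k "Suc k"] by auto
    \<comment> \<open>Letters below \<open>k\<close> in the last coordinate are interchangeable on
      \<open>l\<close>, so only the sections at \<open>0\<close> and at \<open>k\<close> matter:
      hence \<open>2 * r\<close> predicates.\<close>
    define G where "G = (\<lambda>P z. P (z @ plug l [0])) ` F \<union> (\<lambda>P z. P (z @ plug l [k])) ` F"
    have "card G \<le> card F + card F"
      unfolding G_def by (rule order.trans[OF card_Un_le]) (intro add_mono card_image_le, use F in auto)
    then have G: "finite G" "card G \<le> 2 * r" using F by (auto simp: G_def)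
    obtain u where u: "u \<in> subspaces (Suc k) s m" and
      "\<forall>P\<in>G. \<forall>p\<le>s. constant_on (words k p) (\<lambda>w. P (plug u (w @ replicate (s - p) k)))"
      by (rule unavoidableE[OF m G], rule that)
    note u2 = bspec[OF this(2)]
    define v where "v = join_sub s u l"
    have v: "v \<in> subspaces (Suc k) (Suc s) (m + n)"
      using join_sub_in[OF u l'] by (simp add: v_def)
    have plug_v: "plug v (x @ [a]) = plug u x @ plug l [a]" if "length x = s" for x a
      using plug_join_sub[OF u that] by (simp add: v_def)
    have "P (plug v (w @ replicate (Suc s - p) k)) \<longleftrightarrow> P (plug v (w' @ replicate (Suc s - p) k))"
      if P: "P \<in> F" and p: "p \<le> Suc s" and w: "w \<in> words k p" "w' \<in> words k p" for P p w w'
    proof (cases "p = Suc s")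
      case True
      have 1: "\<exists>x\<in>words k s. P (plug v t) \<longleftrightarrow> P (plug u x @ plug l [0])"
        if t: "t \<in> words k (Suc s)" for t
      proof -
        obtain x y where xy: "x \<in> words k s" "y \<in> words k 1" "t = x @ y"
          using t words_append_split[of t k s 1] by auto
        then obtain a where a: "y = [a]" "a < k" by (auto simp: words_def length_Suc_conv)
        have "plug u x \<in> words (Suc k) m"
          using plug_in_words[OF u] xy(1) words_mono[of k "Suc k"] by auto
        then have "constant_on {..<k} (\<lambda>a. P (plug u x @ plug l [a]))"
          using l2[OF P] by blast
        from constant_onD[OF this, of a 0] a assms(2)
        have "P (plug v t) \<longleftrightarrow> P (plug u x @ plug l [0])"
          using xy plug_v[of x a] by (simp add: length_words)
        then show ?thesis using xy(1) by blast
      qed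
      have "(\<lambda>z. P (z @ plug l [0])) \<in> G" using P by (auto simp: G_def)
      from u2[OF this] have "constant_on (words k s) (\<lambda>w. P (plug u w @ plug l [0]))" by force
      note 2 = constant_onD[OF this]
      obtain x x' where "x \<in> words k s" "x' \<in> words k s"
        "P (plug v w) \<longleftrightarrow> P (plug u x @ plug l [0])" "P (plug v w') \<longleftrightarrow> P (plug u x' @ plug l [0])"
        using 1[of w] 1[of w'] w True by blast
      then show ?thesis using 2[of x x'] by (simp add: True)
    next
      case False
      then have *: "replicate (Suc s - p) k = replicate (s - p) k @ [k]"
        using p by (simp add: Suc_diff_le replicate_append_same)
      have "(\<lambda>z. P (z @ plug l [k])) \<in> G" using P by (auto simp: G_def)
      from u2[OF this] have "constant_on (words k p)
          (\<lambda>w. P (plug u (w @ replicate (s - p) k) @ plug l [k]))"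
        using False p by auto
      from constant_onD[OF this w] show ?thesis
        using plug_v[of "w @ replicate (s - p) k" k] plug_v[of "w' @ replicate (s - p) k" k] 
          False p w by (simp add: length_words *)
    qed
    with v show "\<exists>v \<in> subspaces (Suc k) (Suc s) (m + n). \<forall>P\<in>F. \<forall>p\<le>Suc s.
        constant_on (words k p) (\<lambda>w. P (plug v (w @ replicate (Suc s - p) k)))"
      unfolding constant_on_def by blast
  qed
  then show ?case ..
qed

text \<open>A colour is the set of predicates of \<open>F\<close> that hold, so there are at most
  \<open>2 ^ r\<close> colours, and two of the \<open>s + 1\<close> words consisting of
  \<open>p\<close> zeros followed by letters \<open>k\<close> have the same colour.\<close>

lemma hales_jewett_Suc:
  assumes "hales_jewett k" "k > 0"
  shows "hales_jewett (Suc k)"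
  unfolding hales_jewett_def
proof (intro allI)
  fix r :: nat
  define s where "s = (2::nat) ^ r"
  obtain m where m: "unavoidable r (subspaces (Suc k) s m)
     (\<lambda>P u. \<forall>p\<le>s. constant_on (words k p) (\<lambda>w. P (plug u (w @ replicate (s - p) k))))"
    using hales_jewett_focus[OF assms] ..
  have "unavoidable r (subspaces (Suc k) 1 m)
     (\<lambda>P l. constant_on {..<Suc k} (\<lambda>a. P (plug l [a])))"
  proof (rule unavoidableI)
    fix F :: "(nat list \<Rightarrow> bool) set"
    assume F: "finite F" "card F \<le> r"
    obtain u where u: "u \<in> subspaces (Suc k) s m" and
      "\<forall>P\<in>F. \<forall>p\<le>s. constant_on (words k p) (\<lambda>w. P (plug u (w @ replicate (s - p) k)))"
      by (rule unavoidableE[OF m F], rule that)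
    note u2 = bspec[OF this(2)]
    define x where "x p = replicate p 0 @ replicate (s - p) k" for p :: nat
    define colour where "colour p = {P \<in> F. P (plug u (x p))}" for p
    have "card (colour ` {..s}) \<le> card (Pow F)"
      using F by (intro card_mono) (auto simp: colour_def)
    also have "\<dots> \<le> s"
      using F by (simp add: card_Pow s_def)
    finally have "\<not> inj_on colour {..s}"
      by (intro pigeonhole) simp
    then obtain p q where pq: "p < q" "q \<le> s" "colour p = colour q"
      unfolding inj_on_def by (metis atMost_iff linorder_neqE_nat)
    \<comment> \<open>The variable occupies the positions where \<open>x p\<close> and
      \<open>x q\<close> differ. At the letter \<open>k\<close> the line gives \<open>x p\<close>;
      at smaller letters it gives a word of focusing class \<open>q\<close>, coloured like
      \<open>x q\<close>.\<close>
    define t :: "(nat + nat) list" where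
      "t = replicate p (Inl 0) @ replicate (q - p) (Inr 0) @ replicate (s - q) (Inl k)"
    have t: "t \<in> subspaces (Suc k) 1 s"
      using pq by (auto simp: subspaces_def t_def)
    have plug_t: "plug t [a] = replicate p 0 @ replicate (q - p) a @ replicate (s - q) k" for a
      by (simp add: t_def plug_def)
    define l where "l = compose_sub u t"
    have l: "l \<in> subspaces (Suc k) 1 m"
      unfolding l_def by (rule compose_sub_in[OF u t])
    have plug_l: "plug l [a] = plug u (plug t [a])" for a
      unfolding l_def using plug_compose_sub[OF u] t length_subspaces by blast
    have same: "P (plug l [a]) \<longleftrightarrow> P (plug u (x p))" if P: "P \<in> F" and a: "a < Suc k" for P a
    proof (cases "a = k")
      case True
      have "plug t [k] = x p"
        using pq by (simp add: plug_t x_def flip: replicate_add)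
      then show ?thesis using True by (simp add: plug_l)
    next
      case False
      have 1: "constant_on (words k q) (\<lambda>w. P (plug u (w @ replicate (s - q) k)))"
        using u2[OF P] \<open>q \<le> s\<close> by blast
      have "replicate p 0 @ replicate (q - p) a \<in> words k (p + (q - p))"
        using False a assms(2) by (intro append_in_words replicate_in_words) auto
      then have "replicate p 0 @ replicate (q - p) a \<in> words k q"
        using pq by simp
      from constant_onD[OF 1 this replicate_in_words[OF assms(2)]]
      have "P (plug l [a]) \<longleftrightarrow> P (plug u (x q))"
        by (simp add: plug_l plug_t x_def)
      also have "\<dots> \<longleftrightarrow> P (plug u (x p))"
        using pq(3) P by (auto simp: colour_def)
      finally show ?thesis .
    qed
    have "constant_on {..<Suc k} (\<lambda>a. P (plug l [a]))" if "P \<in> F" for P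
      by (rule constant_onI) (simp add: same[OF that])
    with l show "\<exists>l \<in> subspaces (Suc k) 1 m. \<forall>P\<in>F. constant_on {..<Suc k} (\<lambda>a. P (plug l [a]))"
      by blast
  qed
  then show "\<exists>m. unavoidable r (subspaces (Suc k) 1 m)
     (\<lambda>P l. constant_on {..<Suc k} (\<lambda>a. P (plug l [a])))" ..
qed

theorem hales_jewett: "k > 0 \<Longrightarrow> hales_jewett k"
proof (induction k rule: nat_induct_non_zero)
  case 1
  have "[Inr 0] \<in> subspaces 1 1 1" by (auto simp: subspaces_def)
  then show ?case
    unfolding hales_jewett_def unavoidable_def constant_on_def by (auto intro!: exI[of _ 1])
qed (simp add: hales_jewett_Suc)

text \<open>One coordinate at a time: a line that is monochromatic behind every prefix of length
  \<open>m\<close> is fixed first, after which its letter may be set to \<open>0\<close> and the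
  prefix is treated by induction.\<close>

lemma hales_jewett_multidim:
  assumes "K > 0"
  shows "\<exists>m. unavoidable r (subspaces K d m) (\<lambda>P u. constant_on (words K d) (\<lambda>x. P (plug u x)))"
proof (induction d arbitrary: r)
  case 0
  have "[] \<in> subspaces K 0 0" by (simp add: subspaces_def)
  then show ?case
    by (intro exI[of _ 0] unavoidableI bexI[of _ "[]"]) (auto simp: constant_on_def)
next
  case (Suc d)
  obtain m where m: "unavoidable r (subspaces K d m)
      (\<lambda>P u. constant_on (words K d) (\<lambda>x. P (plug u x)))"
    using Suc.IH ..
  obtain n where n: "unavoidable r (subspaces K 1 n)
     (\<lambda>P l. \<forall>z \<in> words K m. constant_on {..<K} (\<lambda>a. P (z @ plug l [a])))"
    using hales_jewett_sections[OF hales_jewett[OF assms]] ..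
  have "unavoidable r (subspaces K (Suc d) (m + n))
      (\<lambda>P v. constant_on (words K (Suc d)) (\<lambda>x. P (plug v x)))"
  proof (rule unavoidableI)
    fix F :: "(nat list \<Rightarrow> bool) set"
    assume F: "finite F" "card F \<le> r"
    obtain l where l: "l \<in> subspaces K 1 n" and
      "\<forall>P\<in>F. \<forall>z \<in> words K m. constant_on {..<K} (\<lambda>a. P (z @ plug l [a]))"
      by (rule unavoidableE[OF n F], rule that)
    note l2 = bspec[OF this(2)]
    define G where "G = (\<lambda>P z. P (z @ plug l [0])) ` F"
    have G: "finite G" "card G \<le> r"
      using F card_image_le[of F "\<lambda>P z. P (z @ plug l [0])"] by (auto simp: G_def)
    obtain u where u: "u \<in> subspaces K d m" and
      "\<forall>P\<in>G. constant_on (words K d) (\<lambda>x. P (plug u x))"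
      by (rule unavoidableE[OF m G], rule that)
    note u2 = bspec[OF this(2)]
    define v where "v = join_sub d u l"
    have v: "v \<in> subspaces K (Suc d) (m + n)"
      using join_sub_in[OF u l] by (simp add: v_def)
    have 1: "\<exists>x \<in> words K d. P (plug v t) \<longleftrightarrow> P (plug u x @ plug l [0])"
      if P: "P \<in> F" and t: "t \<in> words K (Suc d)" for t P
    proof -
      obtain x y where xy: "x \<in> words K d" "y \<in> words K 1" "t = x @ y"
        using t words_append_split[of t K d 1] by auto
      then obtain a where a: "y = [a]" "a < K" by (auto simp: words_def length_Suc_conv)
      have "constant_on {..<K} (\<lambda>a. P (plug u x @ plug l [a]))"
        using l2[OF P] plug_in_words[OF u xy(1)] by blast
      from constant_onD[OF this, of a 0] show ?thesis
        using xy a assms plug_join_sub[OF u, of x l "[a]"] by (auto simp: v_def length_words)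
    qed
    have "P (plug v x) \<longleftrightarrow> P (plug v y)"
      if P: "P \<in> F" and xy: "x \<in> words K (Suc d)" "y \<in> words K (Suc d)" for P x y
    proof -
      have "(\<lambda>z. P (z @ plug l [0])) \<in> G" using P by (auto simp: G_def)
      note 2 = constant_onD[OF u2[OF this]]
      obtain x' y' where "x' \<in> words K d" "y' \<in> words K d"
        "P (plug v x) \<longleftrightarrow> P (plug u x' @ plug l [0])" "P (plug v y) \<longleftrightarrow> P (plug u y' @ plug l [0])"
        using 1[OF P xy(1)] 1[OF P xy(2)] by blast
      then show ?thesis using 2[of x' y'] by simp
    qed
    with v show "\<exists>u \<in> subspaces K (Suc d) (m + n).
     \<forall>P\<in>F. constant_on (words K (Suc d)) (\<lambda>x. P (plug u x))"
      unfolding constant_on_def by blast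
  qed
  then show ?case ..
qed

text \<open>The constants \<open>k\<close> become a new variable, and setting it to \<open>k\<close>
  restores them. The additional first position ensures that this variable occurs even if
  \<open>u\<close> has no constant \<open>k\<close>.\<close>

lemma subspace_absorb_letter:
  assumes "u \<in> subspaces (Suc k) d n"
  obtains v where "v \<in> subspaces k (Suc d) (Suc n)" "\<And>x. plug v (k # x) = k # plug u x"
proof
  define f :: "nat + nat \<Rightarrow> nat + nat" where
    "f = case_sum (\<lambda>a. if a = k then Inr 0 else Inl a) (\<lambda>j. Inr (Suc j))"
  have "f t = Inl a \<longleftrightarrow> a \<noteq> k \<and> t = Inl a" for t a
    by (cases t) (auto simp: f_def)
  then have l: "Inl a \<in> f ` set u \<longleftrightarrow> a \<noteq> k \<and> Inl a \<in> set u" for a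
    by (metis (no_types, lifting) image_iff)
  have "f t = Inr (Suc j) \<longleftrightarrow> t = Inr j" for t j
    by (cases t) (auto simp: f_def)
  then have r: "Inr (Suc j) \<in> f ` set u \<longleftrightarrow> Inr j \<in> set u" for j
    by (metis (no_types, lifting) image_iff)
  have "Inr j \<in> insert (Inr 0) (f ` set u) \<longleftrightarrow> j < Suc d" for j
    using assms r by (cases j) (auto simp: subspaces_def)
  then show "Inr 0 # map f u \<in> subspaces k (Suc d) (Suc n)"
    using assms by (auto simp: subspaces_def l less_Suc_eq)
  have "case_sum id (nth (k # x)) (f t) = case_sum id (nth x) t" for t x
    by (cases t) (auto simp: f_def)
  then show "plug (Inr 0 # map f u) (k # x) = k # plug u x" for x
    by (simp add: plug_def)
qed

text \<open>A fragment of the Graham--Rothschild theorem for lines over \<open>{..<k}\<close>, these being the words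
  that contain the letter \<open>k\<close>: the colour of \<open>v @ x\<close> depends on \<open>v\<close> only. The constant letters \<open>k\<close>
  of a monochromatic subspace are harmless since they can be merged with an earlier variable.\<close>

lemma graham_rothschild_fragment:
  "\<exists>m. unavoidable r (subspaces k (j + d) m) (\<lambda>P u. \<forall>v \<in> words (Suc k) j. k \<in> set v \<longrightarrow>
     constant_on (words (Suc k) d) (\<lambda>x. P (plug u (v @ x))))"
proof (induction j arbitrary: r)
  case 0
  \<comment> \<open>The empty word \<open>v\<close> does not contain \<open>k\<close>, so the
    condition is vacuous.\<close>
  show ?case
    using ident_in_subspaces[of d k] 
    by (intro exI[of _ d] unavoidableI bexI[of _ "map Inr [0..<d]"]) auto
next
  case (Suc j)
  obtain m where m: "unavoidable (r * k) (subspaces k (j + d) m) (\<lambda>P u.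
     \<forall>v \<in> words (Suc k) j. k \<in> set v \<longrightarrow> constant_on (words (Suc k) d) (\<lambda>x. P (plug u (v @ x))))"
    using Suc.IH ..
  obtain n where n: "unavoidable r (subspaces (Suc k) m n)
     (\<lambda>P u. constant_on (words (Suc k) m) (\<lambda>x. P (plug u x)))"
    using hales_jewett_multidim[OF zero_less_Suc] ..
  have "unavoidable r (subspaces k (Suc j + d) (Suc n)) (\<lambda>P u. \<forall>v \<in> words (Suc k) (Suc j).
     k \<in> set v \<longrightarrow> constant_on (words (Suc k) d) (\<lambda>x. P (plug u (v @ x))))"
  proof (rule unavoidableI)
    fix F :: "(nat list \<Rightarrow> bool) set"
    assume F: "finite F" "card F \<le> r"
    \<comment> \<open>This treats the words \<open>v\<close> that begin with \<open>k\<close>: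
      everything behind that letter is made monochromatic at once.\<close>
    define G where "G = (\<lambda>P z. P (k # z)) ` F"
    have G: "finite G" "card G \<le> r"
      using F card_image_le[of F "\<lambda>P z. P (k # z)"] by (auto simp: G_def)
    obtain u where u: "u \<in> subspaces (Suc k) m n" and
      "\<forall>P\<in>G. constant_on (words (Suc k) m) (\<lambda>x. P (plug u x))"
      by (rule unavoidableE[OF n G], rule that)
    note u2 = bspec[OF this(2)]
    obtain u0 where u0: "u0 \<in> subspaces k (Suc m) (Suc n)" 
      and plug_u0: "\<And>x. plug u0 (k # x) = k # plug u x"
      using subspace_absorb_letter[OF u] by blast
    \<comment> \<open>A word \<open>v\<close> that begins with \<open>a < k\<close> contains
      \<open>k\<close> further on, so the induction hypothesis applies behind each such
      \<open>a\<close>; this is the source of \<open>r * k\<close>.\<close>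
    define H where "H = (\<lambda>(P, a) x. P (plug u0 (a # x))) ` (F \<times> {..<k})"
    have "card H \<le> card (F \<times> {..<k})"
      unfolding H_def using F by (intro card_image_le) simp
    also have "\<dots> \<le> r * k"
      using F by (simp add: card_cartesian_product)
    finally have H: "finite H" "card H \<le> r * k" using F by (auto simp: H_def)
    obtain u1 where u1: "u1 \<in> subspaces k (j + d) m" and
      "\<forall>P\<in>H. \<forall>v \<in> words (Suc k) j. k \<in> set v \<longrightarrow>
        constant_on (words (Suc k) d) (\<lambda>x. P (plug u1 (v @ x)))"
      by (rule unavoidableE[OF m H], rule that)
    note u12 = bspec[OF this(2)]
    have one: "[Inr 0] \<in> subspaces k 1 1" by (auto simp: subspaces_def)
    define u1' where "u1' = join_sub 1 [Inr 0] u1"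
    have u1': "u1' \<in> subspaces k (Suc j + d) (Suc m)"
      unfolding u1'_def using join_sub_in[OF one u1] by simp
    have plug_u1': "plug u1' (a # x) = a # plug u1 x" for a x
      using plug_join_sub[OF one, of "[a]" u1 x] by (simp add: u1'_def plug_def)
    define w where "w = compose_sub u0 u1'"
    have w: "w \<in> subspaces k (Suc j + d) (Suc n)"
      unfolding w_def by (rule compose_sub_in[OF u0 u1'])
    have plug_w: "plug w (a # x) = plug u0 (a # plug u1 x)" for a x
      unfolding w_def using plug_compose_sub[OF u0 length_subspaces[OF u1']] by (simp add: plug_u1')
    have "P (plug w (v @ x)) \<longleftrightarrow> P (plug w (v @ y))"
      if P: "P \<in> F" and v: "v \<in> words (Suc k) (Suc j)" "k \<in> set v"
        and x: "x \<in> words (Suc k) d" and y: "y \<in> words (Suc k) d" for P v x y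
    proof -
      obtain a v' where v': "v = a # v'" "a < Suc k" "v' \<in> words (Suc k) j"
        using v(1) by (cases v) (auto simp: words_def)
      show ?thesis
      proof (cases "a = k")
        case True
        have u1K: "u1 \<in> subspaces (Suc k) (j + d) m"
          using u1 subspaces_mono[of k "Suc k"] by auto
        have "(\<lambda>z. P (k # z)) \<in> G" using P by (auto simp: G_def)
        from constant_onD[OF u2[OF this] plug_in_words[OF u1K append_in_words[OF v'(3) x]] 
            plug_in_words[OF u1K append_in_words[OF v'(3) y]]]
        show ?thesis by (simp add: v' True plug_w plug_u0)
      next
        case False
        then have "(\<lambda>x. P (plug u0 (a # x))) \<in> H" using P v' by (auto simp: H_def)
        moreover have "k \<in> set v'" using False v by (auto simp: v')
        ultimately have "constant_on (words (Suc k) d) (\<lambda>x. P (plug u0 (a # plug u1 (v' @ x))))"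
          using u12 v'(3) by blast
        from constant_onD[OF this x y] show ?thesis
          by (simp add: v' plug_w)
      qed
    qed
    with w show "\<exists>u \<in> subspaces k (Suc j + d) (Suc n). \<forall>P\<in>F. \<forall>v \<in> words (Suc k) (Suc j).
        k \<in> set v \<longrightarrow> constant_on (words (Suc k) d) (\<lambda>x. P (plug u (v @ x)))"
      unfolding constant_on_def by blast
  qed
  then show ?case ..
qed

section \<open>The density Hales--Jewett theorem\<close>

declare sum_of_bool_eq [simp del] sum_mult_of_bool_eq [simp del] sum_of_bool_mult_eq [simp del]

text \<open>Asking for one dimension \<open>n\<close> instead of all large ones loses nothing:
  \<open>density_hales_jewett_multidim\<close> recovers these by passing to fibres.\<close>

definition density_hales_jewett :: "nat \<Rightarrow> bool" where
  "density_hales_jewett k \<longleftrightarrow> (\<forall>\<delta>>0. \<exists>n. \<forall>A \<subseteq> words k n. \<delta> * real k ^ n \<le> real (card A) \<longrightarrow>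
     (\<exists>l \<in> subspaces k 1 n. \<forall>a<k. plug l [a] \<in> A))"

section \<open>Dense fibres along lines, and the multidimensional theorem\<close>

lemma card_eq_sum_words:
  assumes "A \<subseteq> words k n"
  shows "real (card A) = (\<Sum>w\<in>words k n. of_bool (w \<in> A))"
proof -
  have "A = {w \<in> words k n. w \<in> A}" using assms by auto
  then show ?thesis using real_card_eq_sum[of "words k n" "\<lambda>w. w \<in> A"] by simp
qed

lemma card_eq_sum_fibres:
  assumes "A \<subseteq> words k (m + n)"
  shows "real (card A) = (\<Sum>x\<in>words k m. real (card {y \<in> words k n. x @ y \<in> A}))"
  by (simp add: card_eq_sum_words[OF assms] sum_words_append real_card_eq_sum)

text \<open>That \<theta> is uniform in \<open>Y\<close> and \<open>P\<close> is essential: in the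
  applications \<open>Y\<close> consists of the words on the remaining coordinates, whose number is
  chosen after \<theta>.\<close>

definition dense_line_property :: "nat \<Rightarrow> real \<Rightarrow> nat \<Rightarrow> real \<Rightarrow> bool" where
  "dense_line_property k c m \<theta> \<longleftrightarrow> (\<forall>(Y :: nat list set) P. finite Y \<and> Y \<noteq> {} \<and>
     c * real k ^ m * real (card Y) \<le> (\<Sum>w\<in>words k m. real (card {y \<in> Y. P w y})) \<longrightarrow>
     (\<exists>l \<in> subspaces k 1 m. \<theta> * real (card Y) \<le> real (card {y \<in> Y. \<forall>a<k. P (plug l [a]) y})))"

lemma dense_line_propertyD:
  fixes Y :: "nat list set"
  assumes "dense_line_property k c m \<theta>" "finite Y" "Y \<noteq> {}"
    "c * real k ^ m * real (card Y) \<le> (\<Sum>w\<in>words k m. real (card {y \<in> Y. P w y}))"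
  shows "\<exists>l \<in> subspaces k 1 m. \<theta> * real (card Y) \<le> real (card {y \<in> Y. \<forall>a<k. P (plug l [a]) y})"
  using assms(1)[unfolded dense_line_property_def, THEN spec[of _ Y], THEN spec[of _ P]] assms(2-4)
  by blast

text \<open>Many \<open>y\<close> have a fibre \<open>D y\<close> of density at least
  \<open>c / 2\<close>, and each of these fibres contains a line. As there are finitely many lines,
  some line occurs for a positive proportion of the \<open>y\<close>.\<close>

lemma dense_line_property_exists:
  assumes "density_hales_jewett k" "k > 0" "c > 0"
  shows "\<exists>m \<theta>. \<theta> > 0 \<and> dense_line_property k c m \<theta>"
proof -
  have "c / 2 > 0" using assms by simp
  with assms(1) obtain m where m: "\<And>A. A \<subseteq> words k m \<Longrightarrow> c / 2 * real k ^ m \<le> real (card A) \<Longrightarrow>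
     \<exists>l \<in> subspaces k 1 m. \<forall>a<k. plug l [a] \<in> A"
    unfolding density_hales_jewett_def by blast
  define L where "L = subspaces k 1 m"
  \<comment> \<open>Dividing by one more than the number of lines makes the final count
    strict.\<close>
  define \<theta> where "\<theta> = c / 2 / (real (card L) + 1)"
  have \<theta>: "\<theta> > 0" using assms by (simp add: \<theta>_def add_nonneg_pos)
  have L\<theta>: "real (card L) * \<theta> < c / 2"
    using assms by (simp add: \<theta>_def field_simps)
  have "\<exists>l \<in> L. \<theta> * real (card Y) \<le> real (card {y \<in> Y. \<forall>a<k. P (plug l [a]) y})"
    if Y: "finite Y" "Y \<noteq> {}" and
      large: "c * real k ^ m * real (card Y) \<le> (\<Sum>w\<in>words k m. real (card {y \<in> Y. P w y}))"
    for Y :: "nat list set" and P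
  proof (rule ccontr)
    assume "\<not> ?thesis"
    then have small: "real (card {y \<in> Y. \<forall>a<k. P (plug l [a]) y}) \<le> \<theta> * real (card Y)" if "l \<in> L" for l
      using that by force
    define D where "D y = {w \<in> words k m. P w y}" for y
    define G where "G = {y \<in> Y. c / 2 * real k ^ m \<le> real (card (D y))}"
    have "(\<Sum>w\<in>words k m. real (card {y \<in> Y. P w y})) = (\<Sum>y\<in>Y. real (card (D y)))"
      using Y by (simp add: D_def real_card_eq_sum) (rule sum.swap)
    also have "\<dots> \<le> (\<Sum>y\<in>Y. of_bool (y \<in> G) * real k ^ m + c / 2 * real k ^ m)"
    proof (rule sum_mono)
      fix y assume "y \<in> Y"
      have "card (D y) \<le> card (words k m)"
        by (rule card_mono) (auto simp: D_def)
      then have "real (card (D y)) \<le> real k ^ m"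
        by (simp flip: of_nat_power)
      then show "real (card (D y)) \<le> of_bool (y \<in> G) * real k ^ m + c / 2 * real k ^ m"
        using \<open>y \<in> Y\<close> assms by (cases "y \<in> G") (simp_all add: add_increasing2, simp add: G_def)
    qed
    also have "\<dots> = real (card G) * real k ^ m + c / 2 * real k ^ m * real (card Y)"
    proof -
      have "(\<Sum>y\<in>Y. of_bool (y \<in> G)) = real (card {y \<in> Y. y \<in> G})"
        using Y by (simp add: real_card_eq_sum)
      also have "{y \<in> Y. y \<in> G} = G" by (auto simp: G_def)
      finally show ?thesis by (simp add: sum.distrib flip: sum_distrib_right)
    qed
    finally have "c / 2 * real k ^ m * real (card Y) \<le> real (card G) * real k ^ m"
      using large by simp
    then have "real k ^ m * (c / 2 * real (card Y)) \<le> real k ^ m * real (card G)"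
      by (simp add: mult_ac)
    then have G: "c / 2 * real (card Y) \<le> real (card G)"
      using assms(2) by (subst (asm) mult_le_cancel_left_pos) auto
    have "G \<subseteq> (\<Union>l\<in>L. {y \<in> Y. \<forall>a<k. P (plug l [a]) y})"
    proof
      fix y assume y: "y \<in> G"
      have "D y \<subseteq> words k m" by (auto simp: D_def)
      from m[OF this] y obtain l where "l \<in> subspaces k 1 m" "\<forall>a<k. plug l [a] \<in> D y"
        by (auto simp: G_def)
      with y show "y \<in> (\<Union>l\<in>L. {y \<in> Y. \<forall>a<k. P (plug l [a]) y})"
        by (auto simp: D_def G_def L_def)
    qed
    moreover have finL: "finite L" by (simp add: L_def finite_subspaces)
    ultimately have "card G \<le> (\<Sum>l\<in>L. card {y \<in> Y. \<forall>a<k. P (plug l [a]) y})"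
      using Y by (intro order.trans[OF card_mono card_UN_le]) auto
    then have "real (card G) \<le> (\<Sum>l\<in>L. real (card {y \<in> Y. \<forall>a<k. P (plug l [a]) y}))"
      by (simp flip: of_nat_sum)
    also have "\<dots> \<le> real (card L) * (\<theta> * real (card Y))"
      using small by (rule sum_bounded_above)
    also have "\<dots> < c / 2 * real (card Y)"
      using L\<theta> Y by (simp flip: mult.assoc add: card_gt_0_iff)
    finally show False using G by simp
  qed
  then have "dense_line_property k c m \<theta>"
    unfolding dense_line_property_def L_def by simp
  with \<theta> show ?thesis by blast
qed

text \<open>The first \<open>m\<close> coordinates yield a line whose \<open>k\<close> fibres share
  a set of density \<theta>; that set takes the place of \<open>A\<close> in the remaining
  coordinates.\<close>

lemma density_hales_jewett_multidim:
  assumes "density_hales_jewett k" "k > 0" "\<delta> > 0"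
  shows "\<exists>n0. \<forall>n\<ge>n0. \<forall>A \<subseteq> words k n. \<delta> * real k ^ n \<le> real (card A) \<longrightarrow>
     (\<exists>u \<in> subspaces k d n. \<forall>x \<in> words k d. plug u x \<in> A)"
  using assms(3)
proof (induction d arbitrary: \<delta>)
  case 0
  have "\<exists>u \<in> subspaces k 0 n. \<forall>x \<in> words k 0. plug u x \<in> A"
    if A: "A \<subseteq> words k n" and dense: "\<delta> * real k ^ n \<le> real (card A)" for n A
  proof -
    have "0 < \<delta> * real k ^ n" using 0 assms(2) by simp
    then obtain z where z: "z \<in> A" using dense by (cases "A = {}") auto
    then show ?thesis
      using A by (intro bexI[of _ "map Inl z"] const_in_subspaces) auto
  qed
  then show ?case by blast
next
  case (Suc d)
  obtain m \<theta> where \<theta>: "\<theta> > 0" and m: "dense_line_property k \<delta> m \<theta>"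
    using dense_line_property_exists[OF assms(1,2) Suc.prems] by blast
  obtain n1 where "\<forall>n\<ge>n1. \<forall>A \<subseteq> words k n. \<theta> * real k ^ n \<le> real (card A) \<longrightarrow>
     (\<exists>u \<in> subspaces k d n. \<forall>x \<in> words k d. plug u x \<in> A)"
    using Suc.IH[OF \<theta>] ..
  note n1 = this[rule_format]
  have "\<exists>u \<in> subspaces k (Suc d) n. \<forall>x \<in> words k (Suc d). plug u x \<in> A"
    if n: "n \<ge> m + n1" and A: "A \<subseteq> words k n" "\<delta> * real k ^ n \<le> real (card A)" for n A
  proof -
    obtain n' where n': "n = m + n'" "n' \<ge> n1"
      using n by (metis add.assoc le_add1 le_iff_add)
    have ne: "words k n' \<noteq> {}" using replicate_in_words[OF assms(2)] by blast
    have "\<delta> * real k ^ m * real (card (words k n'))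
        \<le> (\<Sum>w\<in>words k m. real (card {y \<in> words k n'. w @ y \<in> A}))"
      using A card_eq_sum_fibres[of A k m n'] by (simp add: n' power_add)
    from dense_line_propertyD[OF m finite_words ne this] obtain l where l: "l \<in> subspaces k 1 m" and
      lY: "\<theta> * real k ^ n' \<le> real (card {y \<in> words k n'. \<forall>a<k. plug l [a] @ y \<in> A})"
      by auto
    obtain u where u: "u \<in> subspaces k d n'"
        "\<forall>x \<in> words k d. plug u x \<in> {y \<in> words k n'. \<forall>a<k. plug l [a] @ y \<in> A}"
      using n1[OF n'(2) _ lY] by blast
    have "join_sub 1 l u \<in> subspaces k (Suc d) n"
      using join_sub_in[OF l u(1)] n' by simp
    moreover have "plug (join_sub 1 l u) x \<in> A" if x: "x \<in> words k (Suc d)" for x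
    proof -
      obtain a y where "x = a # y" "a < k" "y \<in> words k d"
        using x by (cases x) (auto simp: words_def)
      then show ?thesis
        using plug_join_sub[OF l, of "[a]" u y] u(2) by auto
    qed
    ultimately show ?thesis by blast
  qed
  then show ?case by blast
qed

section \<open>Sets insensitive to exchanging \<open>k\<close> with another letter\<close>

lemma plug_Inl_Cons [simp]: "plug (Inl a # u) x = a # plug u x"
  by (simp add: plug_def)

lemma subspace_fresh_Cons:
  assumes "u \<in> subspaces k d n"
  obtains v where "v \<in> subspaces k (Suc d) (Suc n)" "\<And>a x. plug v (a # x) = a # plug u x"
proof
  have one: "[Inr 0] \<in> subspaces k 1 1" by (auto simp: subspaces_def)
  show "join_sub 1 [Inr 0] u \<in> subspaces k (Suc d) (Suc n)"
    using join_sub_in[OF one assms] by simp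
  show "plug (join_sub 1 [Inr 0] u) (a # x) = a # plug u x" for a x
    using plug_join_sub[OF one, of "[a]" u x] by (simp add: plug_def)
qed

text \<open>Conditioned on the set of positions of the letter \<open>k\<close>, a uniformly random word over
  \<open>{..<Suc k}\<close> is a uniformly random word over \<open>{..<k}\<close> in the remaining positions. The error term
  bounds the number of words with fewer than \<open>p\<close> remaining positions.\<close>

lemma sum_words_condition_last_letter:
  fixes h :: "nat list \<Rightarrow> real"
  assumes "k > 0" "b \<ge> 0" "\<And>w. w \<in> words (Suc k) q \<Longrightarrow> h w \<le> 1"
    and "\<And>p' u. p' \<ge> p \<Longrightarrow> u \<in> subspaces (Suc k) p' q \<Longrightarrow>
      (\<Sum>x\<in>words k p'. h (plug u x)) \<le> b * real k ^ p'"
  shows "(\<Sum>w\<in>words (Suc k) q. h w)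
    \<le> b * real (Suc k) ^ q + (if p = 0 then 0 else 2 ^ p * (1 + real k / 2) ^ q)"
  using assms(3,4)
proof (induction q arbitrary: h p)
  case 0
  have nil: "[] \<in> subspaces (Suc k) 0 0" by (simp add: subspaces_def)
  show ?case
  proof (cases "p = 0")
    case True
    then show ?thesis using 0(2)[OF _ nil] by (simp add: plug_def)
  next
    case False
    have "h [] \<le> 1" using 0(1) by simp
    also have "\<dots> \<le> b + 2 ^ p" using assms(2) by (simp add: add_increasing)
    finally show ?thesis using False by simp
  qed
next
  case (Suc q)
  \<comment> \<open>The power \<open>(1 + k / 2) ^ q\<close> is the sum of 2 to the power -t over
    all words, t being the number of letters below \<open>k\<close>. So \<open>e p q\<close> bounds
    the number of words with t < p as in Markov's inequality; for \<open>p = 0\<close> there are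
    none.\<close>
  define e where "e p q = (if p = 0 then 0 else 2 ^ p * (1 + real k / 2) ^ q)" for p q :: nat
  define h' where "h' x = (\<Sum>a<k. h (a # x)) / real k" for x
  have last: "(\<Sum>x\<in>words (Suc k) q. h (k # x)) \<le> b * real (Suc k) ^ q + e p q"
    unfolding e_def
  proof (rule Suc.IH)
    show "h (k # w) \<le> 1" if "w \<in> words (Suc k) q" for w
      using that Suc.prems(1) by simp
    show "(\<Sum>x\<in>words k p'. h (k # plug u x)) \<le> b * real k ^ p'"
      if "p' \<ge> p" "u \<in> subspaces (Suc k) p' q" for p' u
    proof -
      have "Inl k # u \<in> subspaces (Suc k) p' (Suc q)"
        using that by (auto simp: subspaces_def)
      from Suc.prems(2)[OF that(1) this] show ?thesis by simp
    qed
  qed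
  \<comment> \<open>The first position already avoids \<open>k\<close>, so \<open>p - 1\<close>
    further ones suffice. For \<open>p = 0\<close> the truncated difference leaves the error at
    \<open>0\<close>.\<close>
  have others: "(\<Sum>x\<in>words (Suc k) q. h' x) \<le> b * real (Suc k) ^ q + e (p - 1) q"
    unfolding e_def
  proof (rule Suc.IH)
    show "h' w \<le> 1" if "w \<in> words (Suc k) q" for w
    proof -
      have "(\<Sum>a<k. h (a # w)) \<le> (\<Sum>a<k. 1)"
        using that Suc.prems(1) by (intro sum_mono) simp
      then show ?thesis using assms(1) by (simp add: h'_def)
    qed
    show "(\<Sum>x\<in>words k p'. h' (plug u x)) \<le> b * real k ^ p'"
      if p': "p' \<ge> p - 1" and u: "u \<in> subspaces (Suc k) p' q" for p' u
    proof -
      obtain v where v: "v \<in> subspaces (Suc k) (Suc p') (Suc q)"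
        "\<And>a x. plug v (a # x) = a # plug u x"
        using subspace_fresh_Cons[OF u] by blast
      have "(\<Sum>x\<in>words k p'. h' (plug u x)) = (\<Sum>a<k. \<Sum>x\<in>words k p'. h (a # plug u x)) / real k"
        unfolding h'_def sum_divide_distrib[symmetric] by (subst sum.swap) simp
      also have "(\<Sum>a<k. \<Sum>x\<in>words k p'. h (a # plug u x)) = (\<Sum>x\<in>words k (Suc p'). h (plug v x))"
        by (simp add: sum_words_Suc v(2))
      also have "\<dots> / real k \<le> b * real k ^ Suc p' / real k"
        using Suc.prems(2)[OF _ v(1)] p' by (intro divide_right_mono) auto
      finally show ?thesis using assms(1) by simp
    qed
  qed
  have "(\<Sum>w\<in>words (Suc k) (Suc q). h w)
      = (\<Sum>a<k. \<Sum>x\<in>words (Suc k) q. h (a # x)) + (\<Sum>x\<in>words (Suc k) q. h (k # x))"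
    by (simp add: sum_words_Suc)
  also have "(\<Sum>a<k. \<Sum>x\<in>words (Suc k) q. h (a # x)) = real k * (\<Sum>x\<in>words (Suc k) q. h' x)"
    unfolding h'_def sum_divide_distrib[symmetric] using assms(1) by (subst sum.swap) simp
  also have "\<dots> \<le> real k * (b * real (Suc k) ^ q + e (p - 1) q)"
    using others by (intro mult_left_mono) auto
  also have "real k * (b * real (Suc k) ^ q + e (p - 1) q) + (\<Sum>x\<in>words (Suc k) q. h (k # x))
      \<le> b * real (Suc k) ^ Suc q + (real k * e (p - 1) q + e p q)"
    using last by (simp add: algebra_simps)
  also have "real k * e (p - 1) q + e p q \<le> e p (Suc q)"
  proof (cases "p \<le> 1")
    case True
    then consider "p = 0" | "p = 1" by linarith
    then show ?thesis by cases (auto simp: e_def)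
  next
    case False
    then have "\<exists>p'. p = Suc (Suc p')" by presburger
    then obtain p' where "p = Suc (Suc p')" ..
    then show ?thesis by (simp add: e_def algebra_simps)
  qed
  finally show ?case by (simp add: e_def)
qed

text \<open>Words that differ only by exchanges of \<open>i\<close> and \<open>k\<close> have the
  same image under \<open>rep k i\<close>; comparing \<open>x\<close> with that image therefore
  captures all such exchanges.\<close>

definition insensitive :: "nat \<Rightarrow> nat \<Rightarrow> nat \<Rightarrow> (nat list \<Rightarrow> bool) \<Rightarrow> bool" where
  "insensitive k i n B \<longleftrightarrow> (\<forall>x \<in> words (Suc k) n. B (rep k i x) \<longleftrightarrow> B x)"

lemma insensitiveD: "insensitive k i n B \<Longrightarrow> x \<in> words (Suc k) n \<Longrightarrow> B (rep k i x) \<longleftrightarrow> B x"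
  by (simp add: insensitive_def)

lemma rep_in_words_Suc: "w \<in> words (Suc k) n \<Longrightarrow> i < k \<Longrightarrow> rep k i w \<in> words (Suc k) n"
  using rep_in_words[of w k n i] words_mono[of k "Suc k" n] by auto

lemma insensitive_plug:
  assumes "insensitive k i n B" "i < k" "V \<in> subspaces (Suc k) d n"
  shows "insensitive k i d (\<lambda>x. B (plug V x))"
  unfolding insensitive_def
proof
  fix x assume x: "x \<in> words (Suc k) d"
  have "B (plug V (rep k i x)) \<longleftrightarrow> B (rep k i (plug V (rep k i x)))"
    using insensitiveD[OF assms(1) plug_in_words[OF assms(3) rep_in_words_Suc[OF x assms(2)]]] by simp
  also have "rep k i (plug V (rep k i x)) = rep k i (plug V x)"
    using assms(2) x by (intro rep_plug_rep[OF assms(3)]) (auto simp: length_words)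
  also have "B (rep k i (plug V x)) \<longleftrightarrow> B (plug V x)"
    by (rule insensitiveD[OF assms(1) plug_in_words[OF assms(3) x]])
  finally show "B (plug V (rep k i x)) \<longleftrightarrow> B (plug V x)" .
qed

text \<open>Conditioning on the positions of \<open>k\<close> finds a subspace \<open>u\<close> of
  dimension at least \<open>p\<close> in which the words without \<open>k\<close> meet
  \<open>B\<close> densely, so that \<open>density_hales_jewett k\<close> applies to them.
  Insensitivity carries the result over to words with the letter \<open>k\<close>.\<close>

lemma insensitive_contains_subspace:
  assumes "density_hales_jewett k" "k > 0" "b > 0"
  shows "\<exists>q. \<forall>i<k. \<forall>B. insensitive k i q B \<longrightarrow>
     b * real (Suc k) ^ q \<le> (\<Sum>x\<in>words (Suc k) q. of_bool (B x)) \<longrightarrow>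
     (\<exists>V \<in> subspaces (Suc k) d q. \<forall>t \<in> words (Suc k) d. B (plug V t))"
proof -
  have "b / 2 > 0" using assms by simp
  from density_hales_jewett_multidim[OF assms(1,2) this]
  obtain p where "\<forall>n\<ge>p. \<forall>A \<subseteq> words k n. b / 2 * real k ^ n \<le> real (card A) \<longrightarrow>
     (\<exists>u \<in> subspaces k d n. \<forall>x \<in> words k d. plug u x \<in> A)" ..
  note p = this[rule_format]
  \<comment> \<open>The base is below \<open>1\<close> since \<open>k > 0\<close>. For this
    \<open>q\<close> the error term of the conditioning lemma stays below half of the given
    density.\<close>
  obtain q where "((1 + real k / 2) / real (Suc k)) ^ q < b / 2 / 2 ^ p"
    using real_arch_pow_inv[of "b / 2 / 2 ^ p" "(1 + real k / 2) / real (Suc k)"] assms by auto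
  then have "(1 + real k / 2) ^ q < b / 2 / 2 ^ p * real (Suc k) ^ q"
    by (simp only: power_divide pos_divide_less_eq zero_less_power of_nat_0_less_iff zero_less_Suc)
  then have "2 ^ p * (1 + real k / 2) ^ q < 2 ^ p * (b / 2 / 2 ^ p * real (Suc k) ^ q)"
    by (intro mult_strict_left_mono) auto
  then have q: "2 ^ p * (1 + real k / 2) ^ q < b / 2 * real (Suc k) ^ q"
    by (simp only: mult.assoc[symmetric]) simp
  show ?thesis
  proof (intro exI[of _ q] allI impI)
    fix i B
    assume i: "i < k" and B: "insensitive k i q B"
      and dense: "b * real (Suc k) ^ q \<le> (\<Sum>x\<in>words (Suc k) q. of_bool (B x))"
    show "\<exists>V \<in> subspaces (Suc k) d q. \<forall>t \<in> words (Suc k) d. B (plug V t)"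
    proof (rule ccontr)
      assume no: "\<not> ?thesis"
      have "(\<Sum>x\<in>words k p'. of_bool (B (plug u x))) \<le> b / 2 * real k ^ p'"
        if p': "p' \<ge> p" and u: "u \<in> subspaces (Suc k) p' q" for p' u
      proof (rule ccontr)
        assume "\<not> ?thesis"
        then have "b / 2 * real k ^ p' \<le> real (card {x \<in> words k p'. B (plug u x)})"
          by (simp add: real_card_eq_sum)
        from p[OF p' _ this] obtain v where v: "v \<in> subspaces k d p'"
          "\<forall>x \<in> words k d. plug v x \<in> {x \<in> words k p'. B (plug u x)}"
          by auto
        have v': "v \<in> subspaces (Suc k) d p'" using v(1) subspaces_mono[of k "Suc k"] by auto
        define V where "V = compose_sub u v"
        have V: "V \<in> subspaces (Suc k) d q"
          unfolding V_def by (rule compose_sub_in[OF u v'])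
        have plug_V: "plug V x = plug u (plug v x)" for x
          unfolding V_def by (rule plug_compose_sub[OF u length_subspaces[OF v']])
        have "B (plug V t)" if t: "t \<in> words (Suc k) d" for t
        proof -
          have "plug v (rep k i t) \<in> {x \<in> words k p'. B (plug u x)}"
            using v(2) rep_in_words[OF t i] by blast
          then have "B (plug V (rep k i t))" by (simp add: plug_V)
          then show ?thesis
            using insensitiveD[OF insensitive_plug[OF B i V] t] by simp
        qed
        with V no show False by blast
      qed
      then have "(\<Sum>x\<in>words (Suc k) q. of_bool (B x))
          \<le> b / 2 * real (Suc k) ^ q + (if p = 0 then 0 else 2 ^ p * (1 + real k / 2) ^ q)"
        using assms by (intro sum_words_condition_last_letter) auto
      also have "\<dots> < b / 2 * real (Suc k) ^ q + b / 2 * real (Suc k) ^ q"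
        using q assms by auto
      finally show False using dense by simp
    qed
  qed
qed

section \<open>Functions with nonpositive sums over subspaces, as a dual of partitioning into
  subspaces\<close>

definition nonpositive_on_subspaces :: "nat \<Rightarrow> nat \<Rightarrow> nat \<Rightarrow> (nat list \<Rightarrow> real) \<Rightarrow> bool" where
  "nonpositive_on_subspaces K d n h \<longleftrightarrow>
     (\<forall>V \<in> subspaces K d n. (\<Sum>t\<in>words K d. h (plug V t)) \<le> 0)"

lemma nonpositive_on_subspacesD:
  "nonpositive_on_subspaces K d n h \<Longrightarrow> V \<in> subspaces K d n \<Longrightarrow> (\<Sum>t\<in>words K d. h (plug V t)) \<le> 0"
  by (simp add: nonpositive_on_subspaces_def)

lemma nonpositive_on_subspaces_fibres:
  assumes "nonpositive_on_subspaces K d (m + n) h"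
  shows "x \<in> words K m \<Longrightarrow> nonpositive_on_subspaces K d n (\<lambda>z. h (x @ z))"
    and "z \<in> words K n \<Longrightarrow> nonpositive_on_subspaces K d m (\<lambda>x. h (x @ z))"
proof -
  assume x: "x \<in> words K m"
  show "nonpositive_on_subspaces K d n (\<lambda>z. h (x @ z))"
    unfolding nonpositive_on_subspaces_def
  proof
    fix V assume "V \<in> subspaces K d n"
    then obtain U where "U \<in> subspaces K d (m + n)" "\<And>t. plug U t = x @ plug V t"
      using subspace_const_append[OF x] by blast
    with nonpositive_on_subspacesD[OF assms, of U]
    show "(\<Sum>t\<in>words K d. h (x @ plug V t)) \<le> 0" by simp
  qed
next
  assume z: "z \<in> words K n"
  show "nonpositive_on_subspaces K d m (\<lambda>x. h (x @ z))"
    unfolding nonpositive_on_subspaces_def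
  proof
    fix V assume "V \<in> subspaces K d m"
    then obtain U where "U \<in> subspaces K d (m + n)" "\<And>t. length t = d \<Longrightarrow> plug U t = plug V t @ z"
      using subspace_append_const[OF _ z] by blast
    with nonpositive_on_subspacesD[OF assms, of U]
    show "(\<Sum>t\<in>words K d. h (plug V t @ z)) \<le> 0" by (simp add: length_words)
  qed
qed

text \<open>Greedy removal of \<open>d\<close>-dimensional subspaces from an insensitive set, one block of \<open>q\<close>
  coordinates at a time; removing the same subspace from equal sections keeps what is left
  insensitive in the later blocks. The last term of the bound is a potential which pays for
  each round.\<close>

lemma insensitive_sum_bound:
  fixes h :: "nat list \<Rightarrow> real"
  assumes i: "i < k" and b: "b > 0" and
    q: "\<And>B. insensitive k i q B \<Longrightarrow> b * real (Suc k) ^ q \<le> (\<Sum>x\<in>words (Suc k) q. of_bool (B x)) \<Longrightarrow>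
     \<exists>V \<in> subspaces (Suc k) d q. \<forall>t \<in> words (Suc k) d. B (plug V t)"
    and "insensitive k i (q * T) B" "\<And>x. x \<in> words (Suc k) (q * T) \<Longrightarrow> h x \<le> 1"
      "nonpositive_on_subspaces (Suc k) d (q * T) h"
  shows "real T * (\<Sum>x\<in>words (Suc k) (q * T). h x * of_bool (B x))
    \<le> real T * b * real (Suc k) ^ (q * T)
      + real (Suc k) ^ q * (\<Sum>x\<in>words (Suc k) (q * T). of_bool (B x))"
  using assms(4-6)
proof (induction T arbitrary: B h)
  case 0
  then show ?case by simp
next
  case (Suc T)
  define K where "K = Suc k"
  define n where "n = q * T"
  define N where "N = real K ^ q"
  have qS: "q * Suc T = q + n" by (simp add: n_def)
  have B: "insensitive k i (q + n) B" and h: "\<And>x. x \<in> words K (q + n) \<Longrightarrow> h x \<le> 1"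
    and h_sub: "nonpositive_on_subspaces K d (q + n) h"
    using Suc.prems unfolding qS K_def by auto
  define S where "S z = {x \<in> words K q. B (x @ z)}" for z
  define good where "good z \<longleftrightarrow> b * N \<le> real (card (S z))" for z
  define V where "V X = (SOME V. V \<in> subspaces K d q \<and> (\<forall>t \<in> words K d. plug V t \<in> X))" for X
  define R where "R z = (if good z then plug (V (S z)) ` words K d else {})" for z
  define B1 where "B1 w \<longleftrightarrow> B w \<and> take q w \<notin> R (drop q w)" for w
  have B1: "B1 (x @ z) \<longleftrightarrow> B (x @ z) \<and> x \<notin> R z" if "x \<in> words K q" for x z
    using that by (simp add: B1_def length_words)
  have card_S: "real (card (S z)) = (\<Sum>x\<in>words K q. of_bool (B (x @ z)))" for z
    by (simp add: S_def real_card_eq_sum)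
  have S_rep: "S (rep k i z) = S z" if z: "z \<in> words K n" for z
  proof -
    have "B (x @ rep k i z) \<longleftrightarrow> B (x @ z)" if x: "x \<in> words K q" for x
    proof -
      have xz: "x @ z \<in> words (Suc k) (q + n)" "x @ rep k i z \<in> words (Suc k) (q + n)"
        using x z i rep_in_words_Suc unfolding K_def by (auto intro!: append_in_words)
      have "rep k i (x @ rep k i z) = rep k i (x @ z)"
        using i by (simp add: rep_idem)
      then show ?thesis using insensitiveD[OF B xz(1)] insensitiveD[OF B xz(2)] by simp
    qed
    then show ?thesis by (auto simp: S_def)
  qed
  have V: "V (S z) \<in> subspaces K d q" "\<And>t. t \<in> words K d \<Longrightarrow> plug (V (S z)) t \<in> S z"
    if z: "z \<in> words K n" and "good z" for z
  proof -
    have "insensitive k i q (\<lambda>x. B (x @ z))"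
      unfolding insensitive_def
    proof
      fix x assume x: "x \<in> words (Suc k) q"
      have xz: "x @ z \<in> words (Suc k) (q + n)" "rep k i x @ z \<in> words (Suc k) (q + n)"
        using x z i rep_in_words_Suc unfolding K_def by (auto intro!: append_in_words)
      have "rep k i (rep k i x @ z) = rep k i (x @ z)"
        using i by (simp add: rep_idem)
      then show "B (rep k i x @ z) \<longleftrightarrow> B (x @ z)"
        using insensitiveD[OF B xz(1)] insensitiveD[OF B xz(2)] by simp
    qed
    moreover have "b * real (Suc k) ^ q \<le> (\<Sum>x\<in>words (Suc k) q. of_bool (B (x @ z)))"
      using \<open>good z\<close> unfolding good_def card_S N_def K_def .
    ultimately obtain V' where V': "V' \<in> subspaces K d q" "\<forall>t \<in> words K d. B (plug V' t @ z)"
      using q unfolding K_def by blast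
    then have "V' \<in> subspaces K d q \<and> (\<forall>t \<in> words K d. plug V' t \<in> S z)"
      using plug_in_words[OF V'(1)] by (auto simp: S_def)
    then have "V (S z) \<in> subspaces K d q \<and> (\<forall>t \<in> words K d. plug (V (S z)) t \<in> S z)"
      unfolding V_def by (rule someI)
    then show "V (S z) \<in> subspaces K d q" "\<And>t. t \<in> words K d \<Longrightarrow> plug (V (S z)) t \<in> S z" by auto
  qed
  have R_sub: "R z \<subseteq> S z" if "z \<in> words K n" for z
    using V(2)[OF that] by (auto simp: R_def)
  have split: "(\<Sum>x\<in>words K q. f x * of_bool (B1 (x @ z)))
      = (\<Sum>x\<in>words K q. f x * of_bool (B (x @ z))) - (\<Sum>x\<in>R z. f x)"
    if z: "z \<in> words K n" for z and f :: "nat list \<Rightarrow> real"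
  proof -
    have "(\<Sum>x\<in>R z. f x) = (\<Sum>x\<in>words K q. f x * of_bool (x \<in> R z))"
      using R_sub[OF z] by (intro sum.mono_neutral_cong_left) (auto simp: S_def)
    moreover have "f x * of_bool (B1 (x @ z)) = f x * of_bool (B (x @ z)) - f x * of_bool (x \<in> R z)"
      if "x \<in> words K q" for x
      using R_sub[OF z] that by (auto simp: B1 S_def)
    ultimately show ?thesis by (simp add: sum_subtractf)
  qed
  have hR: "(\<Sum>x\<in>R z. h (x @ z)) \<le> 0" if z: "z \<in> words K n" for z
  proof (cases "good z")
    case True
    have "(\<Sum>x\<in>R z. h (x @ z)) = (\<Sum>t\<in>words K d. h (plug (V (S z)) t @ z))"
      using True inj_on_plug[OF V(1)[OF z True]] by (simp add: R_def sum.reindex)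
    also have "\<dots> \<le> 0"
      by (rule nonpositive_on_subspacesD[OF nonpositive_on_subspaces_fibres(2)[OF h_sub z] V(1)[OF z True]])
    finally show ?thesis .
  qed (simp add: R_def)
  have card_R: "of_bool (good z) \<le> (\<Sum>x\<in>R z. (1::real))" if z: "z \<in> words K n" for z
  proof (cases "good z")
    case True
    have "card (R z) = K ^ d"
      using True inj_on_plug[OF V(1)[OF z True]] by (simp add: R_def card_image)
    then have "1 \<le> card (R z)" by (simp add: K_def)
    then show ?thesis by simp
  qed simp
  have IH: "real T * (\<Sum>z\<in>words K n. h (x @ z) * of_bool (B1 (x @ z)))
      \<le> real T * b * real K ^ n + N * (\<Sum>z\<in>words K n. of_bool (B1 (x @ z)))"
    if x: "x \<in> words K q" for x
    unfolding K_def n_def N_def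
  proof (rule Suc.IH)
    show "insensitive k i (q * T) (\<lambda>z. B1 (x @ z))"
      unfolding insensitive_def
    proof
      fix z assume "z \<in> words (Suc k) (q * T)"
      then have z: "z \<in> words K n" by (simp add: K_def n_def)
      have "good (rep k i z) \<longleftrightarrow> good z" "R (rep k i z) = R z"
        by (simp_all add: good_def R_def S_rep[OF z])
      moreover have "B (x @ rep k i z) \<longleftrightarrow> B (x @ z)"
        using S_rep[OF z] x by (auto simp: S_def)
      ultimately show "B1 (x @ rep k i z) \<longleftrightarrow> B1 (x @ z)" by (simp add: B1[OF x])
    qed
    show "h (x @ z) \<le> 1" if "z \<in> words (Suc k) (q * T)" for z
      using that x h append_in_words unfolding K_def n_def by blast
    show "nonpositive_on_subspaces (Suc k) d (q * T) (\<lambda>z. h (x @ z))"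
      using nonpositive_on_subspaces_fibres(1)[OF h_sub x] unfolding K_def n_def .
  qed
  \<comment> \<open>Removing the sets \<open>R z\<close> does not decrease \<open>X\<close>, as
    \<open>h\<close> sums to at most \<open>0\<close> over each of them, but it decreases
    \<open>Y\<close> by at least the number \<open>G\<close> of good \<open>z\<close>. Good
    \<open>z\<close> cost at most \<open>N * G\<close> in the trivial bound on \<open>X\<close>,
    because \<open>h\<close> is at most \<open>1\<close>, and exactly this is paid by the decrease
    of \<open>N * Y\<close>.\<close>
  define X where "X = (\<Sum>z\<in>words K n. \<Sum>x\<in>words K q. h (x @ z) * of_bool (B (x @ z)))"
  define X1 where "X1 = (\<Sum>z\<in>words K n. \<Sum>x\<in>words K q. h (x @ z) * of_bool (B1 (x @ z)))"
  define Y where "Y = (\<Sum>z\<in>words K n. \<Sum>x\<in>words K q. of_bool (B (x @ z)) :: real)"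
  define Y1 where "Y1 = (\<Sum>z\<in>words K n. \<Sum>x\<in>words K q. of_bool (B1 (x @ z)) :: real)"
  define G where "G = (\<Sum>z\<in>words K n. of_bool (good z) :: real)"
  have "real T * X1 = (\<Sum>x\<in>words K q. real T * (\<Sum>z\<in>words K n. h (x @ z) * of_bool (B1 (x @ z))))"
    unfolding X1_def sum_distrib_left[symmetric] by (subst sum.swap) simp
  also have "\<dots> \<le> (\<Sum>x\<in>words K q. real T * b * real K ^ n + N * (\<Sum>z\<in>words K n. of_bool (B1 (x @ z))))"
    by (rule sum_mono) (rule IH)
  also have "\<dots> = N * (real T * b * real K ^ n) + N * Y1"
    unfolding Y1_def sum.distrib sum_distrib_left[symmetric] by (subst (2) sum.swap) (simp add: N_def)
  finally have 1: "real T * X1 \<le> N * (real T * b * real K ^ n) + N * Y1" .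
  have 2: "X \<le> X1"
    unfolding X_def X1_def
  proof (rule sum_mono)
    fix z assume "z \<in> words K n"
    from split[OF this, of "\<lambda>x. h (x @ z)"] hR[OF this]
    show "(\<Sum>x\<in>words K q. h (x @ z) * of_bool (B (x @ z)))
        \<le> (\<Sum>x\<in>words K q. h (x @ z) * of_bool (B1 (x @ z)))" by linarith
  qed
  have "Y1 \<le> (\<Sum>z\<in>words K n. (\<Sum>x\<in>words K q. of_bool (B (x @ z))) - of_bool (good z))"
    unfolding Y1_def
  proof (rule sum_mono)
    fix z assume "z \<in> words K n"
    from split[OF this, of "\<lambda>_. 1"] card_R[OF this]
    show "(\<Sum>x\<in>words K q. of_bool (B1 (x @ z)) :: real)
        \<le> (\<Sum>x\<in>words K q. of_bool (B (x @ z))) - of_bool (good z)" by simp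
  qed
  then have 3: "Y1 \<le> Y - G" by (simp add: Y_def G_def sum_subtractf)
  have "X \<le> (\<Sum>z\<in>words K n. N * of_bool (good z) + b * N)"
    unfolding X_def
  proof (rule sum_mono)
    fix z assume z: "z \<in> words K n"
    have "(\<Sum>x\<in>words K q. h (x @ z) * of_bool (B (x @ z))) \<le> (\<Sum>x\<in>words K q. of_bool (B (x @ z)))"
      using h append_in_words[OF _ z] by (intro sum_mono) (auto simp: of_bool_def)
    also have "\<dots> = real (card (S z))" by (simp add: card_S)
    also have "\<dots> \<le> N * of_bool (good z) + b * N"
    proof (cases "good z")
      case True
      have "card (S z) \<le> card (words K q)" by (rule card_mono) (auto simp: S_def)
      then have "real (card (S z)) \<le> N" by (simp add: N_def flip: of_nat_power)
      then show ?thesis using True b by (simp add: N_def add_increasing2)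
    qed (simp add: good_def)
    finally show "(\<Sum>x\<in>words K q. h (x @ z) * of_bool (B (x @ z))) \<le> N * of_bool (good z) + b * N" .
  qed
  also have "\<dots> = N * G + b * N * real K ^ n"
    by (simp add: G_def sum.distrib mult_ac flip: sum_distrib_left)
  finally have 4: "X \<le> N * G + b * N * real K ^ n" .
  have "real T * X \<le> real T * X1" using 2 by (intro mult_left_mono) auto
  moreover have "N * Y1 \<le> N * (Y - G)" using 3 by (intro mult_left_mono) (auto simp: N_def)
  ultimately have "real T * X + X \<le> N * (real T * b * real K ^ n) + N * (Y - G) + (N * G + b * N * real K ^ n)"
    using 1 4 by linarith
  then have "real (Suc T) * X \<le> real (Suc T) * b * (N * real K ^ n) + N * Y"
    by (simp add: algebra_simps)
  moreover have "X = (\<Sum>x\<in>words K (q + n). h x * of_bool (B x))"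
    unfolding X_def sum_words_append by (rule sum.swap)
  moreover have "Y = (\<Sum>x\<in>words K (q + n). of_bool (B x))"
    unfolding Y_def sum_words_append by (rule sum.swap)
  ultimately show ?case
    unfolding qS by (simp only: N_def K_def power_add)
qed

text \<open>A partition of the intersection of the \<open>B j\<close> into
  \<open>d\<close>-dimensional subspaces, up to a proportion \<beta> of all words, would give this
  bound; only the bound is kept. The intended \<open>h\<close> is the indicator of a set minus a
  constant, and the hypothesis then bounds the density of that set on subspaces.\<close>

definition small_on_insensitive :: "nat \<Rightarrow> nat \<Rightarrow> nat \<Rightarrow> real \<Rightarrow> nat \<Rightarrow> bool" where
  "small_on_insensitive k s d \<beta> n \<longleftrightarrow> (\<forall>B h. (\<forall>j<s. insensitive k j n (B j)) \<and>
     (\<forall>x \<in> words (Suc k) n. h x \<le> 1) \<and> nonpositive_on_subspaces (Suc k) d n h \<longrightarrow>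
     (\<Sum>x\<in>words (Suc k) n. h x * of_bool (\<forall>j<s. B j x)) \<le> \<beta> * real (Suc k) ^ n)"

lemma small_on_insensitiveD:
  assumes "small_on_insensitive k s d \<beta> n" "\<And>j. j < s \<Longrightarrow> insensitive k j n (B j)"
    "\<And>x. x \<in> words (Suc k) n \<Longrightarrow> h x \<le> 1" "nonpositive_on_subspaces (Suc k) d n h"
  shows "(\<Sum>x\<in>words (Suc k) n. h x * of_bool (\<forall>j<s. B j x)) \<le> \<beta> * real (Suc k) ^ n"
  using assms(1)[unfolded small_on_insensitive_def, THEN spec[of _ B], THEN spec[of _ h]] assms(2-4)
  by blast

lemma small_on_one_insensitive:
  assumes "density_hales_jewett k" "k > 0" "\<beta> > 0"
  shows "\<exists>n. \<forall>i<k. \<forall>B h. insensitive k i n B \<longrightarrow> (\<forall>x \<in> words (Suc k) n. h x \<le> 1) \<longrightarrow>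
     nonpositive_on_subspaces (Suc k) d n h \<longrightarrow>
     (\<Sum>x\<in>words (Suc k) n. h x * of_bool (B x)) \<le> \<beta> * real (Suc k) ^ n"
proof -
  have b: "\<beta> / 2 > 0" using assms by simp
  obtain q where q: "\<forall>i<k. \<forall>B. insensitive k i q B \<longrightarrow>
     \<beta> / 2 * real (Suc k) ^ q \<le> (\<Sum>x\<in>words (Suc k) q. of_bool (B x)) \<longrightarrow>
     (\<exists>V \<in> subspaces (Suc k) d q. \<forall>t \<in> words (Suc k) d. B (plug V t))"
    using insensitive_contains_subspace[OF assms(1,2) b] ..
  \<comment> \<open>With this many rounds the potential term, divided by \<open>T\<close>,
    contributes at most a proportion \<open>\<beta> / 2\<close>.\<close>
  obtain T :: nat where T: "real (Suc k) ^ q / (\<beta> / 2) < real T"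
    using reals_Archimedean2 by blast
  have T0: "real T > 0"
    by (rule le_less_trans[OF _ T]) (use assms in simp)
  have T': "real (Suc k) ^ q \<le> real T * (\<beta> / 2)"
    using T b by (simp add: pos_divide_less_eq)
  show ?thesis
  proof (intro exI[of _ "q * T"] allI impI)
    fix i B and h :: "nat list \<Rightarrow> real"
    assume i: "i < k" and B: "insensitive k i (q * T) B"
      and h: "\<forall>x \<in> words (Suc k) (q * T). h x \<le> 1" "nonpositive_on_subspaces (Suc k) d (q * T) h"
    define N where "N = real (Suc k) ^ (q * T)"
    define X where "X = (\<Sum>x\<in>words (Suc k) (q * T). h x * of_bool (B x))"
    define Y where "Y = (\<Sum>x\<in>words (Suc k) (q * T). of_bool (B x) :: real)"
    have "real T * X \<le> real T * (\<beta> / 2) * N + real (Suc k) ^ q * Y"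
      unfolding X_def Y_def N_def
      by (rule insensitive_sum_bound[OF i b _ B]) (use q[rule_format, OF i] h in auto)
    also have "Y \<le> (\<Sum>x\<in>words (Suc k) (q * T). 1)"
      unfolding Y_def by (intro sum_mono) (simp add: of_bool_def)
    then have "Y \<le> N" by (simp add: N_def)
    then have "real (Suc k) ^ q * Y \<le> (real T * (\<beta> / 2)) * N"
      using T' assms(3) by (intro mult_mono) (auto simp: Y_def intro: sum_nonneg)
    finally have "real T * X \<le> real T * (\<beta> * N)"
      by (simp add: algebra_simps)
    then show "X \<le> \<beta> * N"
      using T0 by (subst (asm) mult_le_cancel_left_pos) auto
  qed
qed

text \<open>The indicator of the first \<open>s\<close> sets is absorbed into the function: by the
  induction hypothesis \<open>h'\<close> has nonpositive sums over \<open>m\<close>-dimensional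
  subspaces, so the case of one set applies to \<open>B s\<close> and \<open>h'\<close>, with
  \<open>m\<close> in place of \<open>d\<close>.\<close>

lemma small_on_insensitive_exists:
  assumes "density_hales_jewett k" "k > 0" "\<beta> > 0" "s \<le> k"
  shows "\<exists>n. small_on_insensitive k s d \<beta> n"
  using assms(3,4)
proof (induction s arbitrary: \<beta>)
  case 0
  have "(\<Sum>x\<in>words (Suc k) d. h x) \<le> \<beta> * real (Suc k) ^ d"
    if "nonpositive_on_subspaces (Suc k) d d h" for h
  proof -
    have "(\<Sum>x\<in>words (Suc k) d. h x) = (\<Sum>x\<in>words (Suc k) d. h (plug (map Inr [0..<d]) x))"
      by (rule sum.cong) (auto simp: plug_ident length_words)
    also have "\<dots> \<le> 0"
      by (rule nonpositive_on_subspacesD[OF that ident_in_subspaces])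
    also have "0 \<le> \<beta> * real (Suc k) ^ d" using 0 by simp
    finally show ?thesis .
  qed
  then have "small_on_insensitive k 0 d \<beta> d" by (simp add: small_on_insensitive_def)
  then show ?case ..
next
  case (Suc s)
  have b: "\<beta> / 2 > 0" and s: "s < k" using Suc.prems by auto
  obtain m where m: "small_on_insensitive k s d (\<beta> / 2) m"
    using Suc.IH[OF b] s by auto
  obtain n where n: "\<forall>i<k. \<forall>B h. insensitive k i n B \<longrightarrow> (\<forall>x \<in> words (Suc k) n. h x \<le> 1) \<longrightarrow>
     nonpositive_on_subspaces (Suc k) m n h \<longrightarrow>
     (\<Sum>x\<in>words (Suc k) n. h x * of_bool (B x)) \<le> \<beta> / 2 * real (Suc k) ^ n"
    using small_on_one_insensitive[OF assms(1,2) b] ..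
  have "(\<Sum>x\<in>words (Suc k) n. h x * of_bool (\<forall>j<Suc s. B j x)) \<le> \<beta> * real (Suc k) ^ n"
    if B: "\<And>j. j < Suc s \<Longrightarrow> insensitive k j n (B j)"
      and h: "\<And>x. x \<in> words (Suc k) n \<Longrightarrow> h x \<le> 1" "nonpositive_on_subspaces (Suc k) d n h" for B h
  proof -
    define h' where "h' x = h x * of_bool (\<forall>j<s. B j x) - \<beta> / 2" for x
    have h'1: "h' x \<le> 1" if "x \<in> words (Suc k) n" for x
      using h(1)[OF that] b by (auto simp: h'_def of_bool_def)
    have "nonpositive_on_subspaces (Suc k) m n h'"
      unfolding nonpositive_on_subspaces_def
    proof
      fix V assume V: "V \<in> subspaces (Suc k) m n"
      have "(\<Sum>t\<in>words (Suc k) m. h (plug V t) * of_bool (\<forall>j<s. B j (plug V t)))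
          \<le> \<beta> / 2 * real (Suc k) ^ m"
      proof (rule small_on_insensitiveD[OF m])
        show "insensitive k j m (\<lambda>t. B j (plug V t))" if "j < s" for j
          using insensitive_plug[OF B _ V] that s by simp
        show "h (plug V t) \<le> 1" if "t \<in> words (Suc k) m" for t
          using h(1) plug_in_words[OF V that] .
        show "nonpositive_on_subspaces (Suc k) d m (\<lambda>t. h (plug V t))"
          unfolding nonpositive_on_subspaces_def
        proof
          fix U assume U: "U \<in> subspaces (Suc k) d m"
          from nonpositive_on_subspacesD[OF h(2) compose_sub_in[OF V U]]
          show "(\<Sum>t\<in>words (Suc k) d. h (plug V (plug U t))) \<le> 0"
            by (simp add: plug_compose_sub[OF V length_subspaces[OF U]])
        qed
      qed
      then show "(\<Sum>t\<in>words (Suc k) m. h' (plug V t)) \<le> 0"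
        by (simp add: h'_def sum_subtractf mult_ac)
    qed
    then have "(\<Sum>x\<in>words (Suc k) n. h' x * of_bool (B s x)) \<le> \<beta> / 2 * real (Suc k) ^ n"
      using n[rule_format, of s "B s" h'] s B[of s] h'1 by simp
    moreover have "(\<Sum>x\<in>words (Suc k) n. h x * of_bool (\<forall>j<Suc s. B j x))
        \<le> (\<Sum>x\<in>words (Suc k) n. h' x * of_bool (B s x) + \<beta> / 2)"
      using b by (intro sum_mono) (auto simp: h'_def of_bool_def less_Suc_eq)
    moreover have "\<dots> = (\<Sum>x\<in>words (Suc k) n. h' x * of_bool (B s x)) + \<beta> / 2 * real (Suc k) ^ n"
      by (simp add: sum.distrib)
    ultimately show ?thesis by linarith
  qed
  then have "small_on_insensitive k (Suc s) d \<beta> n"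
    unfolding small_on_insensitive_def by blast
  then show ?case ..
qed

section \<open>Line-free sets and the critical density\<close>

definition line_free :: "nat \<Rightarrow> nat \<Rightarrow> nat list set \<Rightarrow> bool" where
  "line_free K n A \<longleftrightarrow> A \<subseteq> words K n \<and> (\<forall>l \<in> subspaces K 1 n. \<exists>a<K. plug l [a] \<notin> A)"

lemma line_free_plug:
  assumes "line_free K n A" "V \<in> subspaces K d n"
  shows "line_free K d {x \<in> words K d. plug V x \<in> A}"
  unfolding line_free_def
proof (intro conjI ballI)
  fix l assume l: "l \<in> subspaces K 1 d"
  obtain a where "a < K" "plug (compose_sub V l) [a] \<notin> A"
    using assms(1) compose_sub_in[OF assms(2) l] unfolding line_free_def by blast
  then show "\<exists>a<K. plug l [a] \<notin> {x \<in> words K d. plug V x \<in> A}"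
    by (auto simp: plug_compose_sub[OF assms(2) length_subspaces[OF l]])
qed auto

lemma line_free_fibre:
  assumes "line_free K (m + n) A" "x \<in> words K m"
  shows "line_free K n {y \<in> words K n. x @ y \<in> A}"
proof -
  obtain v where v: "v \<in> subspaces K n (m + n)" "\<And>y. plug v y = x @ plug (map Inr [0..<n]) y"
    using subspace_const_append[OF assms(2) ident_in_subspaces] by blast
  have "{y \<in> words K n. plug v y \<in> A} = {y \<in> words K n. x @ y \<in> A}"
    using v(2) by (auto simp: plug_ident length_words)
  with line_free_plug[OF assms(1) v(1)] show ?thesis by simp
qed

lemma line_through_word:
  assumes "z \<in> words (Suc k) m" "k \<in> set z"
  obtains l where "l \<in> subspaces (Suc k) 1 m" "\<And>a. plug l [a] = rep k a z"
proof
  define f :: "nat \<Rightarrow> nat + nat" where "f a = (if a = k then Inr 0 else Inl a)" for a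
  have "Inl a \<in> f ` set z \<longleftrightarrow> a \<noteq> k \<and> a \<in> set z" for a
    by (auto simp: f_def image_iff)
  moreover have "Inr j \<in> f ` set z \<longleftrightarrow> j = 0" for j
    using assms(2) by (auto simp: f_def image_iff)
  ultimately show "map f z \<in> subspaces (Suc k) 1 m"
    using assms(1) by (auto simp: subspaces_def words_def)
  show "plug (map f z) [a] = rep k a z" for a
    by (auto simp: plug_def rep_def f_def)
qed

text \<open>The points outside an intersection are sorted by the first set that they miss. The
  pieces are disjoint, and each is again an intersection, of some of the sets and one
  complement.\<close>

lemma sum_first_failure:
  fixes k :: nat
  shows "(\<Sum>i<k. of_bool ((\<forall>j<i. Q j) \<and> \<not> Q i)) = (1 - of_bool (\<forall>i<k. Q i) :: real)"
  by (induction k) (auto simp: less_Suc_eq)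

text \<open>Here \<open>c\<close> is the supremum of the densities that line-free sets attain in
  every dimension. Therefore the lower bound holds in all dimensions, the upper bound in some
  dimension depending on \<epsilon>.\<close>

lemma critical_density:
  assumes "\<not> density_hales_jewett K"
  obtains c where "c > 0"
    "\<And>\<epsilon> n. \<epsilon> > 0 \<Longrightarrow> \<exists>A. line_free K n A \<and> (c - \<epsilon>) * real K ^ n \<le> real (card A)"
    "\<And>\<epsilon>. \<epsilon> > 0 \<Longrightarrow> \<exists>n. \<forall>A. line_free K n A \<longrightarrow> real (card A) < (c + \<epsilon>) * real K ^ n"
proof -
  define S where "S = {\<delta>. \<forall>n. \<exists>A. line_free K n A \<and> \<delta> * real K ^ n \<le> real (card A)}"
  obtain \<delta> where \<delta>: "\<delta> > 0" and "\<forall>n. \<exists>A \<subseteq> words K n. \<delta> * real K ^ n \<le> real (card A) \<and>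
     (\<forall>l \<in> subspaces K 1 n. \<exists>a<K. plug l [a] \<notin> A)"
    using assms unfolding density_hales_jewett_def by (auto simp: not_le not_less)
  then have S: "\<delta> \<in> S" unfolding S_def line_free_def by blast
  have bdd: "bdd_above S"
  proof (rule bdd_aboveI)
    fix \<delta> assume "\<delta> \<in> S"
    then obtain A where A: "line_free K 0 A" "\<delta> \<le> real (card A)"
      by (auto simp: S_def dest!: spec[of _ 0])
    have "card A \<le> card {[] :: nat list}"
      using A(1) by (intro card_mono) (auto simp: line_free_def)
    with A(2) show "\<delta> \<le> 1" by simp
  qed
  show ?thesis
  proof (rule that[of "Sup S"])
    show "Sup S > 0" using \<delta> cSup_upper[OF S bdd] by linarith
    fix \<epsilon> :: real assume \<epsilon>: "\<epsilon> > 0"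
    show "\<exists>A. line_free K n A \<and> (Sup S - \<epsilon>) * real K ^ n \<le> real (card A)" for n
    proof -
      obtain \<delta>' where "\<delta>' \<in> S" "Sup S - \<epsilon> < \<delta>'"
        using less_cSupE[of "Sup S - \<epsilon>" S] S \<epsilon> by auto
      then obtain A where "line_free K n A" "\<delta>' * real K ^ n \<le> real (card A)"
        unfolding S_def by blast
      moreover have "(Sup S - \<epsilon>) * real K ^ n \<le> \<delta>' * real K ^ n"
        using \<open>Sup S - \<epsilon> < \<delta>'\<close> by (intro mult_right_mono) auto
      ultimately show ?thesis by (intro exI[of _ A]) auto
    qed
    have "Sup S + \<epsilon> \<notin> S" using cSup_upper[OF _ bdd, of "Sup S + \<epsilon>"] \<epsilon> by auto
    then show "\<exists>n. \<forall>A. line_free K n A \<longrightarrow> real (card A) < (Sup S + \<epsilon>) * real K ^ n"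
      unfolding S_def by (auto simp: not_le)
  qed
qed

text \<open>Near the critical density \<open>c\<close>, almost all fibres of a line-free set \<open>A\<close> have density about
  \<open>c\<close>. On a suitable subspace the sets \<open>D i\<close> of points \<open>x\<close> for which replacing \<open>k\<close> by \<open>i\<close> gives a
  point of \<open>A\<close> have a dense intersection, which is disjoint from \<open>A\<close>. Hence \<open>A\<close> is denser on the
  complement, which is a union of \<open>k\<close> intersections of insensitive sets, and so \<open>A\<close> has density
  greater than \<open>c\<close> on some large subspace.\<close>

lemma density_hales_jewett_Suc:
  assumes dhj: "density_hales_jewett k" and k: "k > 0"
  shows "density_hales_jewett (Suc k)"
proof (rule ccontr)
  define K where "K = Suc k"
  assume "\<not> density_hales_jewett (Suc k)"
  then obtain c where c: "c > 0" and
    low: "\<And>\<epsilon> n. \<epsilon> > 0 \<Longrightarrow> \<exists>A. line_free K n A \<and> (c - \<epsilon>) * real K ^ n \<le> real (card A)" and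
    high: "\<And>\<epsilon>. \<epsilon> > 0 \<Longrightarrow> \<exists>n. \<forall>A. line_free K n A \<longrightarrow> real (card A) < (c + \<epsilon>) * real K ^ n"
    using critical_density unfolding K_def by metis
  have K0: "real K ^ n > 0" for n by (simp add: K_def)
  have "c / 2 > 0" using c by simp
  from dense_line_property_exists[OF dhj k this]
  obtain m0 \<theta> where \<theta>: "\<theta> > 0" and m0: "dense_line_property k (c / 2) m0 \<theta>" by blast
  \<comment> \<open>The intersection of the \<open>D i\<close>, being disjoint from
    \<open>A\<close>, leaves an excess of about \<open>c * \<theta> = 4 * \<gamma>\<close> on its
    complement. The losses \<epsilon>' and \<gamma> use up at most two of these four, and two
    remain.\<close>
  define \<gamma> where "\<gamma> = c * \<theta> / 4"
  have \<gamma>: "\<gamma> > 0" using c \<theta> by (simp add: \<gamma>_def)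
  obtain d where d: "\<And>A. line_free K d A \<Longrightarrow> real (card A) < (c + \<gamma>) * real K ^ d"
    using high[OF \<gamma>] by blast
  \<comment> \<open>The complement of the intersection of the \<open>D i\<close> is cut into
    \<open>k\<close> pieces, which together may contribute \<gamma>.\<close>
  define \<beta> where "\<beta> = \<gamma> / real k"
  have "\<beta> > 0" using \<gamma> k by (simp add: \<beta>_def)
  from small_on_insensitive_exists[OF dhj k this order_refl]
  obtain M where M: "small_on_insensitive k k d \<beta> M" ..
  obtain m where m: "unavoidable 1 (subspaces k (m0 + M) m) (\<lambda>P u. \<forall>v \<in> words (Suc k) m0.
     k \<in> set v \<longrightarrow> constant_on (words (Suc k) M) (\<lambda>x. P (plug u (v @ x))))"
    using graham_rothschild_fragment ..
  define \<epsilon>' where "\<epsilon>' = min (c / 2) \<gamma>"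
  \<comment> \<open>The total may miss \<open>c\<close> by \<epsilon> per fibre, and the other
    fibres may exceed it by \<epsilon> each; a single fibre then falls short by less than
    \<open>2 * real K ^ m * \<epsilon>\<close>.\<close>
  define \<epsilon> where "\<epsilon> = \<epsilon>' / (2 * real K ^ m)"
  have \<epsilon>': "\<epsilon>' > 0" using c \<gamma> by (simp add: \<epsilon>'_def)
  then have \<epsilon>: "\<epsilon> > 0" using K0 by (simp add: \<epsilon>_def)
  have \<epsilon>_\<epsilon>': "2 * real K ^ m * \<epsilon> = \<epsilon>'" using K0[of m] by (simp add: \<epsilon>_def)
  obtain n where n: "\<And>A. line_free K n A \<Longrightarrow> real (card A) < (c + \<epsilon>) * real K ^ n"
    using high[OF \<epsilon>] by blast
  obtain A where A: "line_free K (m + n) A" "(c - \<epsilon>) * real K ^ (m + n) \<le> real (card A)"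
    using low[OF \<epsilon>] by blast
  define F where "F z = {y \<in> words K n. z @ y \<in> A}" for z
  have F_low: "(c - \<epsilon>') * real K ^ n \<le> real (card (F z))" if z: "z \<in> words K m" for z
  proof -
    have "(c - \<epsilon>) * real K ^ (m + n) \<le> (\<Sum>w\<in>words K m. real (card (F w)))"
      using A card_eq_sum_fibres[of A K m n] by (simp add: F_def line_free_def)
    also have "\<dots> = real (card (F z)) + (\<Sum>w\<in>words K m - {z}. real (card (F w)))"
      using z by (intro sum.remove) auto
    also have "(\<Sum>w\<in>words K m - {z}. real (card (F w)))
        \<le> (\<Sum>w\<in>words K m - {z}. (c + \<epsilon>) * real K ^ n)"
      using n line_free_fibre[OF A(1)] unfolding F_def by (intro sum_mono less_imp_le) blast
    also have "\<dots> = (real K ^ m - 1) * ((c + \<epsilon>) * real K ^ n)"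
      using z by (simp add: card_Diff_singleton K_def)
    finally have "(c + \<epsilon> - 2 * real K ^ m * \<epsilon>) * real K ^ n \<le> real (card (F z))"
      by (simp add: algebra_simps power_add)
    moreover have "(c - \<epsilon>') * real K ^ n \<le> (c + \<epsilon> - 2 * real K ^ m * \<epsilon>) * real K ^ n"
      using \<epsilon> K0 unfolding \<epsilon>_\<epsilon>' by (intro mult_right_mono) auto
    ultimately show ?thesis by linarith
  qed
  \<comment> \<open>The fibres over the points \<open>rep k i z\<close> of the line through
    \<open>z\<close> have a substantial common part. This is the one predicate that the colouring
    argument makes independent of the last \<open>M\<close> coordinates.\<close>
  define good where "good z \<longleftrightarrow> \<theta> * real K ^ n \<le> real (card {y \<in> words K n. \<forall>i<k. rep k i z @ y \<in> A})" for z
  obtain u where u: "u \<in> subspaces k (m0 + M) m" and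
    "\<forall>P\<in>{good}. \<forall>v \<in> words (Suc k) m0. k \<in> set v \<longrightarrow>
       constant_on (words (Suc k) M) (\<lambda>x. P (plug u (v @ x)))"
    by (rule unavoidableE[OF m, of "{good}"]) (simp, simp, rule that)
  then have u_const: "\<And>v. v \<in> words K m0 \<Longrightarrow> k \<in> set v \<Longrightarrow>
      constant_on (words K M) (\<lambda>x. good (plug u (v @ x)))"
    by (simp add: K_def)
  have uK: "u \<in> subspaces K (m0 + M) m"
    using u subspaces_mono[of k K] by (auto simp: K_def)
  \<comment> \<open>A word without \<open>k\<close>, hence fixed by every \<open>rep k i\<close>.
    With the last \<open>M\<close> coordinates frozen at \<open>z0\<close>, the dense line property
    provides one good line, and \<open>u_const\<close> carries goodness over to all other
    values.\<close>
  define z0 where "z0 = replicate M (0::nat)"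
  have z0: "z0 \<in> words k M" "rep k i z0 = z0" for i
    using k by (auto simp: z0_def replicate_in_words rep_def)
  have oK: "z0 \<in> words K M" using z0(1) words_mono[of k K] by (auto simp: K_def)
  have ne: "words K n \<noteq> {}" using replicate_in_words[of 0 K n] by (auto simp: K_def)
  have "c / 2 * real k ^ m0 * real (card (words K n))
      \<le> (\<Sum>w\<in>words k m0. real (card {y \<in> words K n. plug u (w @ z0) @ y \<in> A}))"
  proof -
    have "c / 2 * real K ^ n \<le> real (card {y \<in> words K n. plug u (w @ z0) @ y \<in> A})"
      if w: "w \<in> words k m0" for w
    proof -
      have "plug u (w @ z0) \<in> words K m"
        using plug_in_words[OF u append_in_words[OF w z0(1)]] words_mono[of k K] by (auto simp: K_def)
      from F_low[OF this] have "(c - \<epsilon>') * real K ^ n \<le> real (card {y \<in> words K n. plug u (w @ z0) @ y \<in> A})"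
        by (simp add: F_def)
      moreover have "c / 2 * real K ^ n \<le> (c - \<epsilon>') * real K ^ n"
        using K0 by (intro mult_right_mono) (auto simp: \<epsilon>'_def)
      ultimately show ?thesis by linarith
    qed
    then have "(\<Sum>w\<in>words k m0. c / 2 * real K ^ n)
        \<le> (\<Sum>w\<in>words k m0. real (card {y \<in> words K n. plug u (w @ z0) @ y \<in> A}))"
      by (rule sum_mono)
    then show ?thesis by (simp add: mult_ac)
  qed
  from dense_line_propertyD[OF m0 finite_words ne this]
  obtain l where l: "l \<in> subspaces k 1 m0" and
    lY: "\<theta> * real K ^ n \<le> real (card {y \<in> words K n. \<forall>i<k. plug u (plug l [i] @ z0) @ y \<in> A})"
    by auto
  have lK: "l \<in> subspaces K 1 m0"
    using l subspaces_mono[of k K] by (auto simp: K_def)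
  define v where "v = plug l [k]"
  have v: "v \<in> words K m0" unfolding v_def
    by (rule plug_in_words[OF lK]) (simp add: words_def K_def)
  have kv: "k \<in> set v"
  proof -
    have "Inr 0 \<in> set l" using l by (simp add: subspaces_def)
    then have "case_sum id (nth [k]) (Inr 0) \<in> set v"
      unfolding v_def plug_def set_map by (rule imageI)
    then show ?thesis by simp
  qed
  have rep_v: "rep k i v = plug l [i]" for i
    unfolding v_def using rep_plug[OF l, of "[k]"] by (simp add: rep_def)
  define g where "g x = plug u (v @ x)" for x
  have rep_g: "rep k i (g x) = plug u (plug l [i] @ rep k i x)" if "x \<in> words K M" for i x
    unfolding g_def using rep_plug[OF u, of "v @ x" i] v that by (simp add: rep_v length_words)
  have gK: "g x \<in> words K m" if "x \<in> words K M" for x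
    unfolding g_def by (rule plug_in_words[OF uK append_in_words[OF v that]])
  have "good (g z0)"
    unfolding good_def using lY by (simp add: rep_g[OF oK] z0)
  then have good: "good (g x)" if "x \<in> words K M" for x
    using constant_onD[OF u_const[OF v kv] oK that] by (simp add: g_def)
  have kg: "k \<in> set (g x)" if "x \<in> words K M" for x
  proof -
    obtain j where j: "j < m0" "v ! j = k" using kv v by (auto simp: in_set_conv_nth length_words)
    then have "Inr j \<in> set u" using u by (simp add: subspaces_def)
    then have "case_sum id (nth (v @ x)) (Inr j) \<in> set (g x)"
      unfolding g_def plug_def set_map by (rule imageI)
    then show ?thesis using j v by (simp add: nth_append length_words)
  qed
  define a where "a x y \<longleftrightarrow> g x @ y \<in> A" for x y
  define D where "D i x y \<longleftrightarrow> plug u (plug l [i] @ rep k i x) @ y \<in> A" for i x y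
  \<comment> \<open>Otherwise the whole line through \<open>g x\<close>, followed by
    \<open>y\<close>, would lie in \<open>A\<close>.\<close>
  have disjoint: "\<not> (\<forall>i<k. D i x y)" if "a x y" and x: "x \<in> words K M" and y: "y \<in> words K n" for x y
  proof
    assume D: "\<forall>i<k. D i x y"
    obtain t where t: "t \<in> subspaces K 1 m" "\<And>a. plug t [a] = rep k a (g x)"
      using line_through_word[of "g x" k m] gK[OF x] kg[OF x] unfolding K_def by blast
    obtain t' where t': "t' \<in> subspaces K 1 (m + n)" "\<And>a. length a = 1 \<Longrightarrow> plug t' a = plug t a @ y"
      using subspace_append_const[OF t(1) y] by blast
    have "plug t' [i] \<in> A" if "i < K" for i
    proof (cases "i = k")
      case True
      then show ?thesis using \<open>a x y\<close> by (simp add: t t' a_def)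
    next
      case False
      then show ?thesis using D that by (simp add: t t' D_def rep_g[OF x] K_def)
    qed
    with t'(1) A(1) show False by (auto simp: line_free_def)
  qed
  \<comment> \<open>The excess of \<open>A\<close> over density \<open>c + \<gamma>\<close> on the
    complement of the intersection of the \<open>D i\<close>; by \<open>disjoint\<close>,
    restricting to this complement loses no point of \<open>A\<close>.\<close>
  define f where "f y = (\<Sum>x\<in>words K M. of_bool (a x y) - (c + \<gamma>) * (1 - of_bool (\<forall>i<k. D i x y)))" for y
  have "\<exists>y \<in> words K n. 2 * \<gamma> * real K ^ M \<le> f y"
  proof (rule ccontr)
    assume "\<not> ?thesis"
    then have "(\<Sum>y\<in>words K n. f y) < (\<Sum>y\<in>words K n. 2 * \<gamma> * real K ^ M)"
      using ne by (intro sum_strict_mono) auto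
    also have "\<dots> = real K ^ M * (2 * \<gamma> * real K ^ n)" by simp
    also have "\<dots> = (\<Sum>x\<in>words K M. 2 * \<gamma> * real K ^ n)" by simp
    also have "\<dots> \<le> (\<Sum>x\<in>words K M. \<Sum>y\<in>words K n.
        of_bool (a x y) - (c + \<gamma>) * (1 - of_bool (\<forall>i<k. D i x y)))"
    proof (rule sum_mono)
      fix x assume x: "x \<in> words K M"
      have 1: "(c - \<epsilon>') * real K ^ n \<le> (\<Sum>y\<in>words K n. of_bool (a x y))"
        using F_low[OF gK[OF x]] by (simp add: F_def a_def real_card_eq_sum)
      have 2: "\<theta> * real K ^ n \<le> (\<Sum>y\<in>words K n. of_bool (\<forall>i<k. D i x y))"
        using good[OF x] unfolding good_def by (simp add: rep_g[OF x] D_def real_card_eq_sum)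
      have "2 * \<gamma> \<le> c - \<epsilon>' - (c + \<gamma>) + (c + \<gamma>) * \<theta>"
      proof -
        have "c * \<theta> = 4 * \<gamma>" "\<epsilon>' \<le> \<gamma>" by (auto simp: \<gamma>_def \<epsilon>'_def)
        moreover have "0 \<le> \<gamma> * \<theta>" using \<gamma> \<theta> by simp
        ultimately show ?thesis by (simp add: algebra_simps)
      qed
      then have "2 * \<gamma> * real K ^ n \<le> (c - \<epsilon>' - (c + \<gamma>) + (c + \<gamma>) * \<theta>) * real K ^ n"
        using K0 by (intro mult_right_mono) auto
      also have "\<dots> = (c - \<epsilon>') * real K ^ n - (c + \<gamma>) * real K ^ n + (c + \<gamma>) * (\<theta> * real K ^ n)"
        by (simp add: algebra_simps)
      also have "\<dots> \<le> (\<Sum>y\<in>words K n. of_bool (a x y)) - (c + \<gamma>) * real K ^ n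
          + (c + \<gamma>) * (\<Sum>y\<in>words K n. of_bool (\<forall>i<k. D i x y))"
        using 1 2 c \<gamma> by (intro add_mono diff_mono mult_left_mono) auto
      also have "\<dots> = (\<Sum>y\<in>words K n. of_bool (a x y) - (c + \<gamma>) * (1 - of_bool (\<forall>i<k. D i x y)))"
        by (simp add: sum_subtractf right_diff_distrib flip: sum_distrib_left)
      finally show "2 * \<gamma> * real K ^ n
          \<le> (\<Sum>y\<in>words K n. of_bool (a x y) - (c + \<gamma>) * (1 - of_bool (\<forall>i<k. D i x y)))" .
    qed
    also have "\<dots> = (\<Sum>y\<in>words K n. f y)"
      unfolding f_def by (rule sum.swap)
    finally show False by simp
  qed
  then obtain y where y: "y \<in> words K n" and fy: "2 * \<gamma> * real K ^ M \<le> f y" by blast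
  define h where "h x = of_bool (a x y) - (c + \<gamma>)" for x
  have "f y = (\<Sum>x\<in>words K M. \<Sum>i<k. h x * of_bool ((\<forall>j<i. D j x y) \<and> \<not> D i x y))"
    unfolding f_def sum_distrib_left[symmetric] sum_first_failure
    using disjoint y by (intro sum.cong) (auto simp: h_def of_bool_def)
  also have "\<dots> = (\<Sum>i<k. \<Sum>x\<in>words K M. h x * of_bool ((\<forall>j<i. D j x y) \<and> \<not> D i x y))"
    by (rule sum.swap)
  also have "\<dots> \<le> (\<Sum>i<k. \<beta> * real K ^ M)"
  proof (rule sum_mono)
    fix i assume "i \<in> {..<k}"
    then have i: "i < k" by simp
    \<comment> \<open>Padding with \<open>True\<close>, which is insensitive to every letter, gives
      each piece the same number \<open>k\<close> of sets.\<close>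
    define B where "B j x \<longleftrightarrow> (if j < i then D j x y else if j = i then \<not> D i x y else True)" for j x
    have "(\<forall>j<k. B j x) \<longleftrightarrow> (\<forall>j<i. D j x y) \<and> \<not> D i x y" for x
      using i by (auto simp: B_def)
    moreover have "(\<Sum>x\<in>words (Suc k) M. h x * of_bool (\<forall>j<k. B j x)) \<le> \<beta> * real (Suc k) ^ M"
    proof (rule small_on_insensitiveD[OF M])
      show "insensitive k j M (B j)" if "j < k" for j
        using that by (auto simp: insensitive_def B_def D_def rep_idem)
      show "h x \<le> 1" for x using c \<gamma> by (simp add: h_def of_bool_def)
      show "nonpositive_on_subspaces (Suc k) d M h"
        unfolding nonpositive_on_subspaces_def
      proof
        fix V assume V: "V \<in> subspaces (Suc k) d M"
        obtain V1 where V1: "V1 \<in> subspaces K d (m0 + M)" "\<And>t. plug V1 t = v @ plug V t"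
          using subspace_const_append[OF v] V unfolding K_def by blast
        obtain V2 where V2: "V2 \<in> subspaces K d (m + n)"
            "\<And>t. length t = d \<Longrightarrow> plug V2 t = plug (compose_sub u V1) t @ y"
          using subspace_append_const[OF compose_sub_in[OF uK V1(1)] y] by blast
        have "plug V2 t = g (plug V t) @ y" if "t \<in> words K d" for t
          using V2(2) that by (simp add: plug_compose_sub[OF uK length_subspaces[OF V1(1)]] V1(2) g_def length_words)
        then have "{t \<in> words K d. plug V2 t \<in> A} = {t \<in> words K d. a (plug V t) y}"
          by (auto simp: a_def)
        with d[OF line_free_plug[OF A(1) V2(1)]]
        have "(\<Sum>t\<in>words K d. of_bool (a (plug V t) y)) < (c + \<gamma>) * real K ^ d"
          by (simp add: real_card_eq_sum)
        then show "(\<Sum>t\<in>words (Suc k) d. h (plug V t)) \<le> 0"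
          by (simp add: h_def sum_subtractf K_def mult_ac)
      qed
    qed
    ultimately show "(\<Sum>x\<in>words K M. h x * of_bool ((\<forall>j<i. D j x y) \<and> \<not> D i x y)) \<le> \<beta> * real K ^ M"
      by (simp add: K_def)
  qed
  also have "\<dots> = \<gamma> * real K ^ M" using k by (simp add: \<beta>_def)
  finally have "\<gamma> * real K ^ M \<le> 0" using fy by simp
  moreover have "\<gamma> * real K ^ M > 0" using \<gamma> K0 by simp
  ultimately show False by simp
qed

theorem density_hales_jewett: "k > 0 \<Longrightarrow> density_hales_jewett k"
proof (induction k rule: nat_induct_non_zero)
  case 1
  have l: "[Inr 0] \<in> subspaces 1 1 1" by (auto simp: subspaces_def)
  show ?case
    unfolding density_hales_jewett_def
  proof (intro allI impI exI[of _ 1])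
    fix \<delta> :: real and A assume \<delta>: "\<delta> > 0" and A: "A \<subseteq> words 1 1" "\<delta> * real 1 ^ 1 \<le> real (card A)"
    then obtain w where "w \<in> A" by (cases "A = {}") auto
    moreover from this A(1) have "w = [0]" by (auto simp: words_def length_Suc_conv)
    ultimately show "\<exists>l \<in> subspaces 1 1 1. \<forall>a<1. plug l [a] \<in> A"
      using l by (intro bexI[of _ "[Inr 0]"]) (auto simp: plug_def)
  qed
qed (simp add: density_hales_jewett_Suc)

section \<open>Homothetic grids in dense plane sets\<close>

text \<open>Summing letter values sends a line to a homothetic copy of these values. Its ratio, the
  number of occurrences of the variable, becomes the gap \<open>q\<close>.\<close>

lemma sum_list_map_plug_line:
  fixes f :: "nat \<Rightarrow> nat"
  assumes "\<And>j. Inr j \<in> set l \<Longrightarrow> j = 0"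
  shows "sum_list (map f (plug l [a]))
    = sum_list (map (case_sum f (\<lambda>_. 0)) l) + count_list l (Inr 0) * f a"
  using assms
proof (induction l)
  case (Cons t l)
  then have "sum_list (map f (plug l [a]))
    = sum_list (map (case_sum f (\<lambda>_. 0)) l) + count_list l (Inr 0) * f a" by simp
  moreover have "j = 0" if "t = Inr j" for j using Cons.prems[of j] that by simp
  ultimately show ?case by (cases t) (auto simp: plug_def)
qed (simp add: plug_def)

text \<open>A point of \<open>B\<close> that is not a shifted point of the square lies in one of two
  strips of width \<open>L\<close> along the axes.\<close>

lemma card_shift_bound:
  fixes B :: "(nat \<times> nat) set"
  assumes "B \<subseteq> {..<N} \<times> {..<N}" "s \<le> L" "t \<le> L"
  shows "card B \<le> card {v \<in> {..<N} \<times> {..<N}. (fst v + s, snd v + t) \<in> B} + 2 * L * N"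
proof -
  define V where "V = {v \<in> {..<N} \<times> {..<N}. (fst v + s, snd v + t) \<in> B}"
  have finV: "finite V" unfolding V_def by simp
  have "B \<subseteq> (\<lambda>v. (fst v + s, snd v + t)) ` V \<union> ({..<L} \<times> {..<N} \<union> {..<N} \<times> {..<L})"
  proof
    fix p assume p: "p \<in> B"
    show "p \<in> (\<lambda>v. (fst v + s, snd v + t)) ` V \<union> ({..<L} \<times> {..<N} \<union> {..<N} \<times> {..<L})"
    proof (cases "fst p < s \<or> snd p < t")
      case True
      then show ?thesis using p assms by (cases p) auto
    next
      case False
      then have "(fst p - s, snd p - t) \<in> V" "p = (fst p - s + s, snd p - t + t)"
        using p assms(1) by (cases p; auto simp: V_def)+
      then show ?thesis by (metis (no_types, lifting) UnI1 fst_conv imageI snd_conv)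
    qed
  qed
  then have "card B \<le> card ((\<lambda>v. (fst v + s, snd v + t)) ` V \<union> ({..<L} \<times> {..<N} \<union> {..<N} \<times> {..<L}))"
    using finV by (intro card_mono) auto
  also have "\<dots> \<le> card ((\<lambda>v. (fst v + s, snd v + t)) ` V) + card ({..<L} \<times> {..<N} \<union> {..<N} \<times> {..<L})"
    by (rule card_Un_le)
  also have "\<dots> \<le> card V + (card ({..<L} \<times> {..<N}) + card ({..<N} \<times> {..<L}))"
    using finV by (intro add_mono card_image_le card_Un_le)
  finally show ?thesis by (simp add: V_def card_cartesian_product mult_ac)
qed

text \<open>A word is sent to the sum of the grid points that its letters stand for. Averaging over
  translates \<open>v\<close> of this map yields one under which the preimage of \<open>B\<close>
  has density at least \<open>\<delta> / 2\<close>, and a line in this preimage is sent to a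
  homothetic grid.\<close>

theorem grid_in_dense_set:
  fixes \<delta> :: real and r :: nat
  assumes "\<delta> > 0"
  shows "\<exists>N0. \<forall>N\<ge>N0. \<forall>B \<subseteq> {..<N} \<times> {..<N}. \<delta> * (real N)\<^sup>2 \<le> real (card B) \<longrightarrow>
    (\<exists>q>0. \<exists>c1 c2. \<forall>i\<le>r. \<forall>j\<le>r. (c1 + q * i, c2 + q * j) \<in> B)"
proof -
  define R where "R = Suc r"
  have "R * R > 0" "\<delta> / 2 > 0" using assms by (auto simp: R_def)
  then obtain n where n: "\<forall>A \<subseteq> words (R * R) n. \<delta> / 2 * real (R * R) ^ n \<le> real (card A) \<longrightarrow>
      (\<exists>l \<in> subspaces (R * R) 1 n. \<forall>a<R * R. plug l [a] \<in> A)"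
    using density_hales_jewett[of "R * R"] unfolding density_hales_jewett_def by blast
  define W where "W = words (R * R) n"
  define L where "L = n * r"
  \<comment> \<open>The letter \<open>a\<close> encodes the grid point
    \<open>(a mod R, a div R)\<close>.\<close>
  define s where "s x = sum_list (map (\<lambda>a. a mod R) x)" for x
  define t where "t x = sum_list (map (\<lambda>a. a div R) x)" for x
  have s: "s x \<le> L" if "x \<in> W" for x
  proof -
    have "s x \<le> sum_list (map (\<lambda>_. r) x)"
      unfolding s_def by (rule sum_list_mono) (simp add: R_def less_Suc_eq_le flip: less_Suc_eq_le)
    then show ?thesis using that by (simp add: sum_list_triv W_def L_def length_words)
  qed
  have t: "t x \<le> L" if x: "x \<in> W" for x
  proof -
    have "a div R \<le> r" if "a \<in> set x" for a
    proof -
      have "a < R * R" using that x by (auto simp: W_def words_def)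
      then have "a div R < R" by (simp add: less_mult_imp_div_less)
      then show ?thesis by (simp add: R_def)
    qed
    then have "t x \<le> sum_list (map (\<lambda>_. r) x)"
      unfolding t_def by (intro sum_list_mono)
    then show ?thesis using x by (simp add: sum_list_triv W_def L_def length_words)
  qed
  \<comment> \<open>For such \<open>N\<close> the loss \<open>2 * L * N\<close> from shifting is at
    most half of \<open>\<delta> * N\<^sup>2\<close>.\<close>
  obtain N0 :: nat where N0: "4 * real L / \<delta> < real N0"
    using reals_Archimedean2 by blast
  show ?thesis
  proof (rule exI[of _ N0], intro allI impI)
    fix N B
    assume N: "N \<ge> N0" and B: "B \<subseteq> {..<N} \<times> {..<N}" and dense: "\<delta> * (real N)\<^sup>2 \<le> real (card B)"
    define V where "V = {..<N} \<times> {..<N}"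
    define A where "A v = {x \<in> W. (fst v + s x, snd v + t x) \<in> B}" for v
    have "4 * real L < \<delta> * real N0"
      using N0 assms by (simp add: pos_divide_less_eq mult.commute)
    also have "\<dots> \<le> \<delta> * real N" using N assms by simp
    finally have LN: "4 * real L \<le> \<delta> * real N" and N_pos: "N > 0" by (auto intro: ccontr)
    have "\<exists>v\<in>V. \<delta> / 2 * real (R * R) ^ n \<le> real (card (A v))"
    proof (rule ccontr)
      assume "\<not> ?thesis"
      then have "real (card (A v)) < \<delta> / 2 * real (R * R) ^ n" if "v \<in> V" for v
        using that by force
      then have "(\<Sum>v\<in>V. real (card (A v))) < (\<Sum>v\<in>V. \<delta> / 2 * real (R * R) ^ n)"
        using N_pos unfolding V_def by (intro sum_strict_mono) auto
      also have "\<dots> = real (R * R) ^ n * (\<delta> / 2 * (real N)\<^sup>2)"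
        by (simp add: V_def card_cartesian_product power2_eq_square)
      also have "\<dots> = (\<Sum>x\<in>W. \<delta> / 2 * (real N)\<^sup>2)"
        by (simp add: W_def)
      also have "\<dots> \<le> (\<Sum>x\<in>W. real (card {v \<in> V. (fst v + s x, snd v + t x) \<in> B}))"
      proof (rule sum_mono)
        fix x assume x: "x \<in> W"
        have "real (card B) \<le> real (card {v \<in> V. (fst v + s x, snd v + t x) \<in> B}) + 2 * real L * real N"
          using card_shift_bound[OF B s[OF x] t[OF x]] unfolding V_def
          by (metis (mono_tags) of_nat_add of_nat_le_iff of_nat_mult of_nat_numeral)
        moreover have "4 * real L * real N \<le> \<delta> * real N * real N"
          using LN by (intro mult_right_mono) auto
        ultimately show "\<delta> / 2 * (real N)\<^sup>2 \<le> real (card {v \<in> V. (fst v + s x, snd v + t x) \<in> B})"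
          using dense by (simp add: power2_eq_square)
      qed
      also have "\<dots> = (\<Sum>v\<in>V. real (card (A v)))"
      proof -
        have "finite V" "finite W" by (auto simp: V_def W_def)
        then show ?thesis by (simp add: A_def real_card_eq_sum) (rule sum.swap)
      qed
      finally show False by simp
    qed
    then obtain v where "\<delta> / 2 * real (R * R) ^ n \<le> real (card (A v))" by blast
    with n obtain l where l: "l \<in> subspaces (R * R) 1 n" "\<forall>a<R * R. plug l [a] \<in> A v"
      unfolding A_def W_def by (metis (no_types, lifting) mem_Collect_eq subsetI)
    define q where "q = count_list l (Inr 0)"
    have "Inr 0 \<in> set l" using l by (simp add: subspaces_def)
    then have q: "q > 0" unfolding q_def using count_list_0_iff by fastforce
    have Inr0: "j = 0" if "Inr j \<in> set l" for j using l(1) that by (simp add: subspaces_def)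
    define c1 where "c1 = fst v + sum_list (map (case_sum (\<lambda>a. a mod R) (\<lambda>_. 0)) l)"
    define c2 where "c2 = snd v + sum_list (map (case_sum (\<lambda>a. a div R) (\<lambda>_. 0)) l)"
    have "(c1 + q * i, c2 + q * j) \<in> B" if "i \<le> r" "j \<le> r" for i j
    proof -
      define a where "a = i + j * R"
      have "j * R \<le> r * R" using that by simp
      then have "a < R * R" unfolding a_def using that by (simp add: R_def)
      moreover have "i < R" using that by (simp add: R_def)
      then have "a mod R = i" "a div R = j" by (auto simp: a_def)
      ultimately show ?thesis
        using l(2) sum_list_map_plug_line[OF Inr0, where f = "\<lambda>a. a mod R" and a = a]
          sum_list_map_plug_line[OF Inr0, where f = "\<lambda>a. a div R" and a = a]
        by (auto simp: A_def s_def t_def c1_def c2_def q_def add.assoc)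
    qed
    with q show "\<exists>q>0. \<exists>c1 c2. \<forall>i\<le>r. \<forall>j\<le>r. (c1 + q * i, c2 + q * j) \<in> B" by blast
  qed
qed

section \<open>Level sets of regular subtrees\<close>

text \<open>The sets of levels of those regularly embedded trees with all nodes in \<open>S\<close> that live on the
  first \<open>N\<close> levels.\<close>

primrec level_family :: "'a set \<Rightarrow> nat \<Rightarrow> 'a list set \<Rightarrow> nat set set" where
  "level_family \<Lambda> 0 S = {{}}"
| "level_family \<Lambda> (Suc N) S =
    (`) Suc ` (\<Union>a\<in>\<Lambda>. level_family \<Lambda> N {w. a # w \<in> S}) \<union>
    (if [] \<in> S then (\<lambda>H. insert 0 (Suc ` H)) ` (\<Inter>a\<in>\<Lambda>. level_family \<Lambda> N {w. a # w \<in> S}) else {})"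

definition level_weight :: "'a set \<Rightarrow> nat \<Rightarrow> 'a list set \<Rightarrow> real" where
  "level_weight \<Lambda> N S = (\<Sum>i<N. real (card (S \<inter> layer \<Lambda> i)) / real (card (layer \<Lambda> i)))"

lemma finite_layer: "finite \<Lambda> \<Longrightarrow> finite (layer \<Lambda> i)"
  unfolding layer_def using finite_lists_length_eq[of \<Lambda> i] by (simp add: lists_eq_set)

lemma card_layer: "finite \<Lambda> \<Longrightarrow> card (layer \<Lambda> i) = card \<Lambda> ^ i"
  unfolding layer_def using card_lists_length_eq[of \<Lambda> i] by (simp add: lists_eq_set)

lemma layer_0: "layer \<Lambda> 0 = {[]}"
  by (auto simp: layer_def)

lemma card_layer_Suc:
  assumes "finite \<Lambda>"
  shows "card (S \<inter> layer \<Lambda> (Suc i)) = (\<Sum>a\<in>\<Lambda>. card ({w. a # w \<in> S} \<inter> layer \<Lambda> i))"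
proof -
  have "S \<inter> layer \<Lambda> (Suc i) = (\<Union>a\<in>\<Lambda>. (#) a ` ({w. a # w \<in> S} \<inter> layer \<Lambda> i))"
  proof (intro set_eqI iffI)
    fix w assume "w \<in> S \<inter> layer \<Lambda> (Suc i)"
    then show "w \<in> (\<Union>a\<in>\<Lambda>. (#) a ` ({w. a # w \<in> S} \<inter> layer \<Lambda> i))"
      by (cases w) (auto simp: layer_def)
  qed (auto simp: layer_def)
  also have "card \<dots> = (\<Sum>a\<in>\<Lambda>. card ((#) a ` ({w. a # w \<in> S} \<inter> layer \<Lambda> i)))"
    using assms finite_layer[OF assms] by (intro card_UN_disjoint) auto
  also have "\<dots> = (\<Sum>a\<in>\<Lambda>. card ({w. a # w \<in> S} \<inter> layer \<Lambda> i))"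
    by (intro sum.cong card_image) (auto simp: inj_on_def)
  finally show ?thesis .
qed

lemma level_weight_Suc:
  assumes "finite \<Lambda>" "\<Lambda> \<noteq> {}"
  shows "level_weight \<Lambda> (Suc N) S
    = of_bool ([] \<in> S) + (\<Sum>a\<in>\<Lambda>. level_weight \<Lambda> N {w. a # w \<in> S}) / real (card \<Lambda>)"
proof -
  have "level_weight \<Lambda> (Suc N) S = real (card (S \<inter> {[]}))
      + (\<Sum>i<N. real (card (S \<inter> layer \<Lambda> (Suc i))) / real (card \<Lambda>) ^ Suc i)"
    unfolding level_weight_def sum.lessThan_Suc_shift
    using assms by (simp add: card_layer layer_0)
  also have "real (card (S \<inter> {[]})) = of_bool ([] \<in> S)"
    by simp
  also have "(\<Sum>i<N. real (card (S \<inter> layer \<Lambda> (Suc i))) / real (card \<Lambda>) ^ Suc i)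
      = (\<Sum>i<N. \<Sum>a\<in>\<Lambda>. real (card ({w. a # w \<in> S} \<inter> layer \<Lambda> i)) / real (card \<Lambda>) ^ i) / real (card \<Lambda>)"
    by (simp add: card_layer_Suc[OF assms(1)] sum_divide_distrib mult.commute)
  also have "(\<Sum>i<N. \<Sum>a\<in>\<Lambda>. real (card ({w. a # w \<in> S} \<inter> layer \<Lambda> i)) / real (card \<Lambda>) ^ i)
      = (\<Sum>a\<in>\<Lambda>. level_weight \<Lambda> N {w. a # w \<in> S})"
    unfolding level_weight_def by (subst sum.swap) (simp add: card_layer[OF assms(1)])
  finally show ?thesis .
qed

lemma level_family_subset: "\<Lambda> \<noteq> {} \<Longrightarrow> level_family \<Lambda> N S \<subseteq> Pow {..<N}"
proof (induction N arbitrary: S)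
  case (Suc N)
  have "H \<subseteq> {..<N}" if "a \<in> \<Lambda>" "H \<in> level_family \<Lambda> N {w. a # w \<in> S}" for a H
    using Suc that by blast
  moreover obtain b where "b \<in> \<Lambda>" using Suc.prems by blast
  ultimately show ?case by (fastforce split: if_splits)
qed simp

text \<open>Jensen's inequality for the exponential function, from its tangent at the mean.\<close>

lemma powr_mean_le:
  fixes x :: "'b \<Rightarrow> real"
  assumes "finite A" "A \<noteq> {}" "b > 0"
  shows "real (card A) * b powr ((\<Sum>a\<in>A. x a) / real (card A)) \<le> (\<Sum>a\<in>A. b powr x a)"
proof -
  define m where "m = (\<Sum>a\<in>A. x a) / real (card A)"
  have card: "real (card A) > 0" using assms by (simp add: card_gt_0_iff)
  have "b powr m * (1 + (x a - m) * ln b) \<le> b powr x a" for a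
  proof -
    have "b powr m * (1 + (x a - m) * ln b) \<le> b powr m * exp ((x a - m) * ln b)"
      by (intro mult_left_mono exp_ge_add_one_self) auto
    also have "\<dots> = b powr x a"
      using assms(3) by (simp add: powr_def algebra_simps flip: exp_add)
    finally show ?thesis .
  qed
  then have "(\<Sum>a\<in>A. b powr m * (1 + (x a - m) * ln b)) \<le> (\<Sum>a\<in>A. b powr x a)"
    by (rule sum_mono)
  also have "(\<Sum>a\<in>A. b powr m * (1 + (x a - m) * ln b))
      = b powr m * (real (card A) + ((\<Sum>a\<in>A. x a) - real (card A) * m) * ln b)"
    by (simp add: sum.distrib sum_subtractf flip: sum_distrib_left sum_distrib_right)
  also have "(\<Sum>a\<in>A. x a) - real (card A) * m = 0"
    using card by (simp add: m_def)
  finally show ?thesis by (simp add: m_def mult.commute)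
qed

text \<open>An element of the union that is not in the intersection is counted at most
  \<open>card A - 1\<close> times.\<close>

lemma sum_card_le_Union_Inter:
  assumes "finite A" "A \<noteq> {}" "\<And>a. a \<in> A \<Longrightarrow> finite (F a)"
  shows "real (\<Sum>a\<in>A. card (F a))
    \<le> (real (card A) - 1) * real (card (\<Union>a\<in>A. F a)) + real (card (\<Inter>a\<in>A. F a))"
proof -
  define U where "U = (\<Union>a\<in>A. F a)"
  have finU: "finite U" unfolding U_def using assms by blast
  have "real (card (F a)) = (\<Sum>H\<in>U. of_bool (H \<in> F a))" if "a \<in> A" for a
  proof -
    have "F a = {H \<in> U. H \<in> F a}" using that by (auto simp: U_def)
    then show ?thesis using real_card_eq_sum[OF finU, of "\<lambda>H. H \<in> F a"] by simp
  qed
  then have "real (\<Sum>a\<in>A. card (F a)) = (\<Sum>a\<in>A. \<Sum>H\<in>U. of_bool (H \<in> F a))"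
    by simp
  also have "\<dots> = (\<Sum>H\<in>U. \<Sum>a\<in>A. of_bool (H \<in> F a))" by (rule sum.swap)
  also have "\<dots> \<le> (\<Sum>H\<in>U. real (card A) - 1 + of_bool (H \<in> (\<Inter>a\<in>A. F a)))"
  proof (rule sum_mono)
    fix H
    show "(\<Sum>a\<in>A. of_bool (H \<in> F a)) \<le> real (card A) - 1 + of_bool (H \<in> (\<Inter>a\<in>A. F a))"
    proof (cases "H \<in> (\<Inter>a\<in>A. F a)")
      case True
      have "(\<Sum>a\<in>A. of_bool (H \<in> F a)) \<le> (\<Sum>a\<in>A. 1 :: real)"
        by (intro sum_mono) (simp add: of_bool_def)
      then show ?thesis using True by simp
    next
      case False
      then obtain b where b: "b \<in> A" "H \<notin> F b" by blast
      have "(\<Sum>a\<in>A. of_bool (H \<in> F a)) = (\<Sum>a\<in>A - {b}. of_bool (H \<in> F a) :: real)"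
        using b assms(1) by (simp add: sum.remove[of A b])
      also have "\<dots> \<le> (\<Sum>a\<in>A - {b}. 1)"
        by (intro sum_mono) (simp add: of_bool_def)
      also have "\<dots> = real (card A) - 1"
        using b assms by (simp add: card_gt_0_iff of_nat_diff Suc_leI)
      finally show ?thesis using False by simp
    qed
  qed
  also have "\<dots> = (real (card A) - 1) * real (card U) + (\<Sum>H\<in>U. of_bool (H \<in> (\<Inter>a\<in>A. F a)))"
    by (simp add: sum.distrib)
  also have "(\<Sum>H\<in>U. of_bool (H \<in> (\<Inter>a\<in>A. F a))) = real (card {H \<in> U. H \<in> (\<Inter>a\<in>A. F a)})"
    by (rule real_card_eq_sum[OF finU, symmetric])
  also have "{H \<in> U. H \<in> (\<Inter>a\<in>A. F a)} = (\<Inter>a\<in>A. F a)"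
    using assms(2) by (auto simp: U_def)
  finally show ?thesis by (simp add: U_def)
qed

text \<open>The base comes from the case that the root is in \<open>S\<close>. Relative to the mean
  of the \<open>card (F a)\<close>, the sum \<open>card U + card I\<close> gains a factor 2 if
  \<open>I = U\<close>, and at least \<kappa> / (\<kappa> - 1) if \<open>I\<close> is empty;
  \<open>1 + 1 / \<kappa>\<close> exceeds neither, and the cases in between follow from
  \<open>IU\<close>.\<close>

lemma card_level_family_ge:
  assumes "finite \<Lambda>" "\<Lambda> \<noteq> {}"
  shows "(1 + 1 / real (card \<Lambda>)) powr level_weight \<Lambda> N S \<le> real (card (level_family \<Lambda> N S))"
proof (induction N arbitrary: S)
  case 0
  then show ?case by (simp add: level_weight_def)
next
  case (Suc N)
  define \<kappa> where "\<kappa> = real (card \<Lambda>)"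
  have \<kappa>: "\<kappa> \<ge> 1" using assms by (simp add: \<kappa>_def card_gt_0_iff Suc_leI)
  define \<beta> where "\<beta> = 1 + 1 / \<kappa>"
  have \<beta>: "\<beta> > 0" using \<kappa> by (simp add: \<beta>_def add_pos_nonneg)
  define F where "F a = level_family \<Lambda> N {w. a # w \<in> S}" for a
  define U where "U = (\<Union>a\<in>\<Lambda>. F a)"
  define I where "I = (\<Inter>a\<in>\<Lambda>. F a)"
  have finF: "finite (F a)" for a
    unfolding F_def by (rule finite_subset[OF level_family_subset[OF assms(2)]]) simp
  have finU: "finite U" and finI: "finite I" and IU: "card I \<le> card U"
  proof -
    show U: "finite U" using assms finF by (simp add: U_def)
    have "I \<subseteq> U" using assms(2) by (auto simp: I_def U_def)
    then show "finite I" "card I \<le> card U" using U by (auto intro: finite_subset card_mono)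
  qed
  define m where "m = (\<Sum>a\<in>\<Lambda>. level_weight \<Lambda> N {w. a # w \<in> S}) / \<kappa>"
  have "\<kappa> * \<beta> powr m \<le> (\<Sum>a\<in>\<Lambda>. \<beta> powr level_weight \<Lambda> N {w. a # w \<in> S})"
    unfolding m_def \<kappa>_def using \<beta> assms by (intro powr_mean_le)
  also have "\<dots> \<le> (\<Sum>a\<in>\<Lambda>. real (card (F a)))"
    unfolding F_def \<beta>_def \<kappa>_def by (rule sum_mono) (rule Suc.IH)
  finally have sum_ge: "\<kappa> * \<beta> powr m \<le> (\<Sum>a\<in>\<Lambda>. real (card (F a)))" .
  have card_U: "card ((`) Suc ` U) = card U"
    by (rule card_image) (simp add: inj_on_def inj_image_eq_iff)
  have "inj_on (\<lambda>H. insert 0 (Suc ` H)) I"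
  proof
    fix H H' assume "insert 0 (Suc ` H) = insert 0 (Suc ` H')"
    then have "insert 0 (Suc ` H) - {0} = insert 0 (Suc ` H') - {0}" by simp
    then have "Suc ` H = Suc ` H'" by auto
    then show "H = H'" by (simp add: inj_image_eq_iff)
  qed
  then have card_I: "card ((\<lambda>H. insert 0 (Suc ` H)) ` I) = card I"
    by (rule card_image)
  have "\<beta> powr level_weight \<Lambda> (Suc N) S \<le> real (card (level_family \<Lambda> (Suc N) S))"
  proof (cases "[] \<in> S")
    case False
    have "(\<Sum>a\<in>\<Lambda>. real (card (F a))) \<le> \<kappa> * real (card U)"
      unfolding \<kappa>_def using finU by (intro sum_bounded_above) (auto simp: U_def intro!: card_mono)
    with sum_ge have "\<kappa> * \<beta> powr m \<le> \<kappa> * real (card U)" by linarith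
    then have "\<beta> powr m \<le> real (card U)" using \<kappa> by simp
    moreover have "level_family \<Lambda> (Suc N) S = (`) Suc ` U"
      using False by (simp add: U_def F_def)
    ultimately show ?thesis
      using False card_U assms by (simp add: level_weight_Suc m_def \<kappa>_def del: level_family.simps)
  next
    case True
    have "card (level_family \<Lambda> (Suc N) S) = card ((`) Suc ` U \<union> (\<lambda>H. insert 0 (Suc ` H)) ` I)"
      using True by (simp add: U_def I_def F_def)
    also have "\<dots> = card ((`) Suc ` U) + card ((\<lambda>H. insert 0 (Suc ` H)) ` I)"
      using finU finI by (intro card_Un_disjoint) auto
    finally have card: "card (level_family \<Lambda> (Suc N) S) = card U + card I"
      by (simp only: card_U card_I)
    have "(\<Sum>a\<in>\<Lambda>. real (card (F a))) \<le> (\<kappa> - 1) * real (card U) + real (card I)"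
      using sum_card_le_Union_Inter[OF assms finF] by (simp add: \<kappa>_def U_def I_def)
    with sum_ge have "\<kappa> * \<beta> powr m \<le> (\<kappa> - 1) * real (card U) + real (card I)" by linarith
    then have "(\<kappa> + 1) * (\<kappa> * \<beta> powr m) \<le> (\<kappa> + 1) * ((\<kappa> - 1) * real (card U) + real (card I))"
      using \<kappa> by (intro mult_left_mono) auto
    also have "\<dots> = \<kappa> * \<kappa> * (real (card U) + real (card I)) - (real (card U) - real (card I))
        - (\<kappa> * (\<kappa> - 1)) * real (card I)"
      by (simp add: algebra_simps)
    also have "\<dots> \<le> \<kappa> * \<kappa> * (real (card U) + real (card I))"
    proof -
      have "0 \<le> (\<kappa> * (\<kappa> - 1)) * real (card I)" using \<kappa> by simp
      moreover have "0 \<le> real (card U) - real (card I)" using IU by simp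
      ultimately show ?thesis by linarith
    qed
    finally have "\<kappa> * ((\<kappa> + 1) * \<beta> powr m) \<le> \<kappa> * (\<kappa> * (real (card U) + real (card I)))"
      by (simp add: mult_ac)
    then have "(\<kappa> + 1) * \<beta> powr m \<le> \<kappa> * (real (card U) + real (card I))"
      using \<kappa> by (subst (asm) mult_le_cancel_left_pos) auto
    moreover have "\<kappa> + 1 = \<kappa> * \<beta>" using \<kappa> by (simp add: \<beta>_def field_simps)
    ultimately have "\<kappa> * (\<beta> * \<beta> powr m) \<le> \<kappa> * (real (card U) + real (card I))"
      by (simp add: mult_ac)
    then have "\<beta> * \<beta> powr m \<le> real (card U) + real (card I)"
      using \<kappa> by (subst (asm) mult_le_cancel_left_pos) auto
    moreover have "\<beta> powr level_weight \<Lambda> (Suc N) S = \<beta> * \<beta> powr m"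
      using True assms \<beta> by (simp add: level_weight_Suc m_def \<kappa>_def powr_add)
    ultimately show ?thesis unfolding card by simp
  qed
  then show ?case by (simp only: \<beta>_def \<kappa>_def)
qed

text \<open>The family has exponentially many members, which is more than the number of subsets of
  \<open>{..<N}\<close> of size less than \<open>\<eta> * N\<close>.\<close>

lemma level_family_large_member:
  assumes "finite \<Lambda>" "\<Lambda> \<noteq> {}" "\<delta> > 0"
  shows "\<exists>\<eta>>0. \<forall>N>0. \<forall>S. \<delta> * real N \<le> level_weight \<Lambda> N S \<longrightarrow>
    (\<exists>H \<in> level_family \<Lambda> N S. \<eta> * real N \<le> real (card H))"
proof -
  define \<beta> where "\<beta> = 1 + 1 / real (card \<Lambda>)"
  have \<beta>: "\<beta> > 1" using assms by (simp add: \<beta>_def card_gt_0_iff)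
  \<comment> \<open>Sets \<open>H\<close> of at most \<open>\<eta> * N\<close> elements get the
    weight \<open>x powr (card H - \<eta> * N)\<close>, which is at least \<open>1\<close>; over all
    subsets these weights sum to \<open>((1 + x) * x powr (- \<eta>)) ^ N\<close>. The choices of
    \<open>x\<close> and \<eta> bound the two factors by \<open>\<beta> powr (\<delta> / 2)\<close>
    and \<open>\<beta> powr (\<delta> / 4)\<close>, whose product is less than
    \<open>\<beta> powr \<delta>\<close>. The cap \<open>1 / 2\<close> keeps \<open>ln x\<close>
    negative.\<close>
  define x where "x = min (\<beta> powr (\<delta> / 2) - 1) (1 / 2)"
  have "\<beta> powr 0 < \<beta> powr (\<delta> / 2)" using \<beta> assms by (intro powr_less_mono) auto
  then have "\<beta> powr (\<delta> / 2) > 1" using \<beta> by simp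
  then have x: "0 < x" "x < 1" "1 + x \<le> \<beta> powr (\<delta> / 2)" by (auto simp: x_def)
  define \<eta> where "\<eta> = \<delta> / 4 * ln \<beta> / (- ln x)"
  have lnx: "ln x < 0" using x by simp
  then have \<eta>: "\<eta> > 0" using \<beta> assms unfolding \<eta>_def by (intro divide_pos_pos mult_pos_pos) auto
  have x\<eta>: "x powr (- \<eta>) = \<beta> powr (\<delta> / 4)"
    using lnx x \<beta> by (simp add: powr_def \<eta>_def)
  have "\<exists>H \<in> level_family \<Lambda> N S. \<eta> * real N \<le> real (card H)"
    if N: "N > 0" and weight: "\<delta> * real N \<le> level_weight \<Lambda> N S" for N S
  proof (rule ccontr)
    assume "\<not> ?thesis"
    then have small: "real (card H) \<le> \<eta> * real N" if "H \<in> level_family \<Lambda> N S" for H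
      using that by force
    have sub: "level_family \<Lambda> N S \<subseteq> Pow {..<N}"
      using level_family_subset[OF assms(2)] .
    have "\<beta> powr (\<delta> * real N) \<le> \<beta> powr level_weight \<Lambda> N S"
      using \<beta> weight by simp
    also have "\<dots> \<le> real (card (level_family \<Lambda> N S))"
      unfolding \<beta>_def by (rule card_level_family_ge[OF assms(1,2)])
    also have "\<dots> = (\<Sum>H\<in>level_family \<Lambda> N S. 1)" by simp
    also have "\<dots> \<le> (\<Sum>H\<in>level_family \<Lambda> N S. x ^ card H * x powr (- \<eta> * real N))"
    proof (rule sum_mono)
      fix H assume "H \<in> level_family \<Lambda> N S"
      then have "real (card H) - \<eta> * real N \<le> 0" using small by simp
      then have "x powr 0 \<le> x powr (real (card H) - \<eta> * real N)"
        using x by (intro powr_mono') auto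
      also have "\<dots> = x ^ card H * x powr (- \<eta> * real N)"
        using x powr_add[of x "real (card H)" "- \<eta> * real N"] by (simp add: powr_realpow)
      finally show "1 \<le> x ^ card H * x powr (- \<eta> * real N)" using x by simp
    qed
    also have "\<dots> \<le> (\<Sum>H\<in>Pow {..<N}. x ^ card H * x powr (- \<eta> * real N))"
      using sub x by (intro sum_mono2) auto
    also have "\<dots> = (\<Sum>H\<in>Pow {..<N}. x ^ card H) * x powr (- \<eta> * real N)"
      by (simp add: sum_distrib_right)
    also have "(\<Sum>H\<in>Pow {..<N}. x ^ card H) = (1 + x) ^ N"
      using prod_add[of "{..<N}" "\<lambda>_. x" "\<lambda>_. 1"] by (simp add: add.commute)
    also have "(1 + x) ^ N * x powr (- \<eta> * real N)
        \<le> (\<beta> powr (\<delta> / 2)) ^ N * x powr (- \<eta> * real N)"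
      using x by (intro mult_right_mono power_mono) auto
    also have "(\<beta> powr (\<delta> / 2)) ^ N = \<beta> powr (\<delta> / 2 * real N)"
      using \<beta> by (simp add: powr_powr flip: powr_realpow)
    also have "x powr (- \<eta> * real N) = \<beta> powr (\<delta> / 4 * real N)"
    proof -
      have "x powr (- \<eta> * real N) = (x powr (- \<eta>)) powr real N"
        by (simp only: powr_powr)
      then show ?thesis by (simp only: x\<eta> powr_powr)
    qed
    also have "\<beta> powr (\<delta> / 2 * real N) * \<beta> powr (\<delta> / 4 * real N) = \<beta> powr (3 / 4 * (\<delta> * real N))"
      by (simp flip: powr_add)
    also have "\<dots> < \<beta> powr (\<delta> * real N)"
      using \<beta> assms(3) N by (intro powr_less_mono) auto
    finally show False by simp
  qed
  with \<eta> show ?thesis by blast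
qed

section \<open>Regular trees realising prescribed levels\<close>

definition embeds_tree ::
    "'a set \<Rightarrow> nat \<Rightarrow> nat \<Rightarrow> nat \<Rightarrow> 'a list set \<Rightarrow> ('a list \<Rightarrow> 'a list) \<Rightarrow> bool" where
  "embeds_tree \<Lambda> r q c S \<phi> \<longleftrightarrow> inj_on \<phi> (tree \<Lambda> r) \<and>
     (\<forall>w \<in> tree \<Lambda> r. \<phi> w \<in> S \<and> \<phi> w \<in> lists \<Lambda> \<and> length (\<phi> w) = c + q * length w) \<and>
     (\<forall>w \<in> lists \<Lambda>. \<forall>a \<in> \<Lambda>. length w < r \<longrightarrow> descendent \<Lambda> (\<phi> (w @ [a])) (\<phi> w @ [a]))"

lemma embeds_treeD:
  assumes "embeds_tree \<Lambda> r q c S \<phi>"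
  shows "inj_on \<phi> (tree \<Lambda> r)"
    and "w \<in> tree \<Lambda> r \<Longrightarrow> \<phi> w \<in> S" "w \<in> tree \<Lambda> r \<Longrightarrow> \<phi> w \<in> lists \<Lambda>"
    and "w \<in> tree \<Lambda> r \<Longrightarrow> length (\<phi> w) = c + q * length w"
    and "w \<in> lists \<Lambda> \<Longrightarrow> a \<in> \<Lambda> \<Longrightarrow> length w < r \<Longrightarrow> descendent \<Lambda> (\<phi> (w @ [a])) (\<phi> w @ [a])"
  using assms unfolding embeds_tree_def by blast+

text \<open>Induction on \<open>N\<close> strips the first letter. The target set and the starting
  level change with it, which is why \<open>embeds_tree\<close> carries both \<open>S\<close> and
  \<open>c\<close>.\<close>

lemma level_family_embedding:
  assumes "\<Lambda> \<noteq> {}" "q > 0"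
  shows "H \<in> level_family \<Lambda> N S \<Longrightarrow> (\<And>i. i \<le> r \<Longrightarrow> c + q * i \<in> H) \<Longrightarrow>
    \<exists>\<phi>. embeds_tree \<Lambda> r q c S \<phi>"
proof (induction N arbitrary: H S r c)
  case 0
  from 0(1) 0(2)[of 0] show ?case by simp
next
  case (Suc N)
  have descendent_Cons: "descendent \<Lambda> (b # v) (b # w)" if "descendent \<Lambda> v w" for b :: 'a and v w
    using that by (auto simp: descendent_def)
  show ?case
  proof (cases "c = 0 \<and> 0 \<in> H")
    case False
    \<comment> \<open>The embedded tree starts below the root, even if \<open>0 \<in> H\<close>, so
      one child is enough; an inclusion between the sets of levels suffices because only the levels
      of the progression are used.\<close>
    have "\<exists>a H'. a \<in> \<Lambda> \<and> H' \<in> level_family \<Lambda> N {w. a # w \<in> S} \<and> H \<subseteq> insert 0 (Suc ` H')"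
    proof -
      obtain b where "b \<in> \<Lambda>" using assms(1) by blast
      then show ?thesis using Suc.prems(1) by (auto split: if_splits)
    qed
    then obtain a H' where a: "a \<in> \<Lambda>" and H': "H' \<in> level_family \<Lambda> N {w. a # w \<in> S}"
      "H \<subseteq> insert 0 (Suc ` H')" by blast
    obtain c' where c': "c = Suc c'" using False Suc.prems(2)[of 0] by (cases c) auto
    have "c' + q * i \<in> H'" if "i \<le> r" for i
      using Suc.prems(2)[OF that] H'(2) by (auto simp: c')
    from Suc.IH[OF H'(1) this] obtain \<phi> where "embeds_tree \<Lambda> r q c' {w. a # w \<in> S} \<phi>" ..
    then have "embeds_tree \<Lambda> r q c S (\<lambda>w. a # \<phi> w)"
      using a descendent_Cons by (auto simp: embeds_tree_def inj_on_def c')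
    then show ?thesis by blast
  next
    case True
    then have c: "c = 0" by simp
    obtain H' where nil: "[] \<in> S" and H: "H = insert 0 (Suc ` H')"
      and H': "\<And>a. a \<in> \<Lambda> \<Longrightarrow> H' \<in> level_family \<Lambda> N {w. a # w \<in> S}"
      using Suc.prems(1) True by (auto split: if_splits)
    show ?thesis
    proof (cases r)
      case 0
      have "tree \<Lambda> 0 = {[]}" by (auto simp: tree_def)
      then show ?thesis using 0 nil c by (intro exI[of _ "\<lambda>w. []"]) (auto simp: embeds_tree_def)
    next
      case (Suc r')
      \<comment> \<open>After the root, the next level in use is \<open>q\<close>, which is level
        \<open>q - 1\<close> in the subtree of a child.\<close>
      have "(q - 1) + q * i \<in> H'" if "i \<le> r'" for i
      proof -
        have "0 + q * Suc i \<in> H" using Suc.prems(2)[of "Suc i"] that Suc c by simp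
        moreover have "0 + q * Suc i = Suc ((q - 1) + q * i)" using assms(2) by simp
        ultimately show ?thesis by (auto simp: H)
      qed
      then have "\<forall>a\<in>\<Lambda>. \<exists>\<phi>. embeds_tree \<Lambda> r' q (q - 1) {w. a # w \<in> S} \<phi>"
        using Suc.IH[OF H'] by blast
      from bchoice[OF this] obtain \<psi> where
        "\<forall>a\<in>\<Lambda>. embeds_tree \<Lambda> r' q (q - 1) {w. a # w \<in> S} (\<psi> a)" ..
      note \<psi> = embeds_treeD[OF bspec[OF this]]
      define \<phi> where "\<phi> w = (case w of [] \<Rightarrow> [] | a # v \<Rightarrow> a # \<psi> a v)" for w
      have \<phi>_simps: "\<phi> [] = []" "\<phi> (a # v) = a # \<psi> a v" for a v by (auto simp: \<phi>_def)
      have Cons: "a # v \<in> tree \<Lambda> r \<longleftrightarrow> a \<in> \<Lambda> \<and> v \<in> tree \<Lambda> r'" for a v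
        by (auto simp: tree_def Suc)
      have "inj_on \<phi> (tree \<Lambda> r)"
      proof
        fix v w assume "v \<in> tree \<Lambda> r" "w \<in> tree \<Lambda> r" "\<phi> v = \<phi> w"
        then show "v = w"
          by (cases v; cases w) (auto simp: \<phi>_simps Cons dest: inj_onD[OF \<psi>(1)])
      qed
      moreover have "\<phi> w \<in> S \<and> \<phi> w \<in> lists \<Lambda> \<and> length (\<phi> w) = c + q * length w" if "w \<in> tree \<Lambda> r" for w
        using that \<psi>(2-4) assms(2) by (cases w) (auto simp: \<phi>_simps Cons nil c)
      moreover have "descendent \<Lambda> (\<phi> (w @ [a])) (\<phi> w @ [a])"
        if "w \<in> lists \<Lambda>" "a \<in> \<Lambda>" "length w < r" for w a
      proof (cases w)
        case Nil
        have "[] \<in> tree \<Lambda> r'" by (simp add: tree_def)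
        then show ?thesis using Nil \<psi>(3)[OF that(2), of "[]"] by (auto simp: \<phi>_simps descendent_def)
      next
        case (Cons b v)
        then show ?thesis using that \<psi>(5)[of b v a] descendent_Cons by (simp add: \<phi>_simps Suc)
      qed
      ultimately have "embeds_tree \<Lambda> r q c S \<phi>" by (simp add: embeds_tree_def)
      then show ?thesis by blast
    qed
  qed
qed

section \<open>From dense sections at single words to a grid of levels\<close>

theorem theorem2p3:
  fixes \<Lambda> :: "'a set" and \<delta> :: real and r :: nat
  assumes "finite \<Lambda>" and "\<Lambda> \<noteq> {}" and "\<delta> > 0" and "r > 0"
  shows "\<forall>M. \<exists>N \<ge> M. N > 0 \<and>
    (\<forall>A. A \<subseteq> tree \<Lambda> N \<times> tree \<Lambda> N \<and> density \<Lambda> N A \<ge> \<delta> \<longrightarrow>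
      (\<exists>q > 0. \<exists>\<phi> \<in> tree \<Lambda> r \<times> {0..r} \<rightarrow> A.
        (\<exists>c1 c2. \<forall>u \<in> tree \<Lambda> r. \<forall>j \<in> {0..r}.
           Level (\<phi> (u, j)) = (q * length u + c1, q * j + c2)) \<and>
        (\<forall>j \<in> {0..r}. \<exists>\<phi>j. \<exists>y \<in> tree \<Lambda> N.
           arithmetic_embedding \<Lambda> r N q \<phi>j \<and>
           (\<forall>u \<in> tree \<Lambda> r. \<phi> (u, j) = (\<phi>j u, y)))))"
proof
  fix M :: nat
  have "\<delta> / 2 > 0" using assms by simp
  from level_family_large_member[OF assms(1,2) this] obtain \<eta> where \<eta>: "\<eta> > 0" and
    large: "\<And>N S. N > 0 \<Longrightarrow> \<delta> / 2 * real N \<le> level_weight \<Lambda> N S \<Longrightarrow>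
      \<exists>H \<in> level_family \<Lambda> N S. \<eta> * real N \<le> real (card H)"
    by blast
  have "\<delta> / 2 * \<eta> > 0" using \<eta> assms by simp
  from grid_in_dense_set[OF this, of r] obtain N0 where
    grid: "\<forall>N\<ge>N0. \<forall>B \<subseteq> {..<N} \<times> {..<N}. \<delta> / 2 * \<eta> * (real N)\<^sup>2 \<le> real (card B) \<longrightarrow>
      (\<exists>q>0. \<exists>c1 c2. \<forall>i\<le>r. \<forall>j\<le>r. (c1 + q * i, c2 + q * j) \<in> B)" ..
  define N where "N = Suc (max M N0)"
  have N: "N \<ge> M" "N > 0" "N \<ge> N0" by (auto simp: N_def)
  have "\<exists>q > 0. \<exists>\<phi> \<in> tree \<Lambda> r \<times> {0..r} \<rightarrow> A.
        (\<exists>c1 c2. \<forall>u \<in> tree \<Lambda> r. \<forall>j \<in> {0..r}.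
           Level (\<phi> (u, j)) = (q * length u + c1, q * j + c2)) \<and>
        (\<forall>j \<in> {0..r}. \<exists>\<phi>j. \<exists>y \<in> tree \<Lambda> N.
           arithmetic_embedding \<Lambda> r N q \<phi>j \<and>
           (\<forall>u \<in> tree \<Lambda> r. \<phi> (u, j) = (\<phi>j u, y)))"
    if A: "A \<subseteq> tree \<Lambda> N \<times> tree \<Lambda> N" and dens: "density \<Lambda> N A \<ge> \<delta>" for A
  proof -
    define W where "W j = (\<Sum>i<N. real (card (A \<inter> (layer \<Lambda> i \<times> layer \<Lambda> j))) / real (card (layer \<Lambda> i \<times> layer \<Lambda> j)))" for j
    define S where "S y = {x. (x, y) \<in> A}" for y
    have fin: "finite (layer \<Lambda> i)" for i by (rule finite_layer[OF assms(1)])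
    have pos: "real (card (layer \<Lambda> i)) > 0" for i
      using assms by (simp add: card_layer card_gt_0_iff)
    have W_avg: "real (card (layer \<Lambda> j)) * W j = (\<Sum>y\<in>layer \<Lambda> j. level_weight \<Lambda> N (S y))" for j
    proof -
      have "card (A \<inter> (layer \<Lambda> i \<times> layer \<Lambda> j)) = (\<Sum>y\<in>layer \<Lambda> j. card (S y \<inter> layer \<Lambda> i))" for i
      proof -
        have "A \<inter> (layer \<Lambda> i \<times> layer \<Lambda> j) = (\<Union>y\<in>layer \<Lambda> j. (S y \<inter> layer \<Lambda> i) \<times> {y})"
          by (auto simp: S_def)
        also have "card \<dots> = (\<Sum>y\<in>layer \<Lambda> j. card ((S y \<inter> layer \<Lambda> i) \<times> {y}))"
          using fin by (intro card_UN_disjoint) auto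
        finally show ?thesis by (simp add: card_cartesian_product)
      qed
      then have "real (card (layer \<Lambda> j)) * W j
          = (\<Sum>i<N. \<Sum>y\<in>layer \<Lambda> j. real (card (S y \<inter> layer \<Lambda> i)) / real (card (layer \<Lambda> i)))"
        unfolding W_def sum_distrib_left using pos[of j]
        by (intro sum.cong) (auto simp: card_cartesian_product sum_divide_distrib[symmetric])
      also have "\<dots> = (\<Sum>y\<in>layer \<Lambda> j. level_weight \<Lambda> N (S y))"
        unfolding level_weight_def by (rule sum.swap)
      finally show ?thesis .
    qed
    \<comment> \<open>The \<open>W j\<close> are at most \<open>N\<close> and average at least
      \<open>\<delta> * N\<close>, so at least \<open>\<delta> / 2 * N\<close> of them reach this
      threshold.\<close>
    define good where "good j \<longleftrightarrow> \<delta> / 2 * real N \<le> W j" for j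
    have W_le: "W j \<le> real N" for j
    proof -
      have "card (A \<inter> (layer \<Lambda> i \<times> layer \<Lambda> j)) \<le> card (layer \<Lambda> i \<times> layer \<Lambda> j)" for i
        using fin by (intro card_mono) auto
      then have "W j \<le> (\<Sum>i<N. 1)"
        unfolding W_def by (intro sum_mono) (auto simp: divide_le_eq_1)
      then show ?thesis by simp
    qed
    have "\<delta> * (real N)\<^sup>2 \<le> (\<Sum>j<N. W j)"
    proof -
      have "(\<Sum>j<N. W j) = (\<Sum>i<N. \<Sum>j<N. real (card (A \<inter> (layer \<Lambda> i \<times> layer \<Lambda> j))) / real (card (layer \<Lambda> i \<times> layer \<Lambda> j)))"
        unfolding W_def by (rule sum.swap)
      then have "density \<Lambda> N A = (\<Sum>j<N. W j) / (real N)\<^sup>2"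
        by (simp add: density_def)
      then show ?thesis using dens N(2) by (simp add: pos_le_divide_eq)
    qed
    also have "\<dots> \<le> (\<Sum>j<N. real N * of_bool (good j) + \<delta> / 2 * real N)"
      using W_le assms(3) by (intro sum_mono) (auto simp: good_def of_bool_def add_increasing2)
    also have "\<dots> = real N * real (card {j \<in> {..<N}. good j}) + \<delta> / 2 * (real N)\<^sup>2"
    proof -
      have "(\<Sum>j<N. of_bool (good j)) = real (card {j \<in> {..<N}. good j})"
        by (rule real_card_eq_sum[symmetric]) simp
      then show ?thesis
        unfolding sum.distrib sum_distrib_left[symmetric] by (simp only:) (simp add: power2_eq_square)
    qed
    finally have "\<delta> / 2 * real N * real N \<le> real (card {j \<in> {..<N}. good j}) * real N"
      by (simp add: power2_eq_square algebra_simps)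
    then have good_card: "\<delta> / 2 * real N \<le> real (card {j \<in> {..<N}. good j})"
      using N(2) by simp
    have "\<exists>y H. y \<in> layer \<Lambda> j \<and> H \<in> level_family \<Lambda> N (S y) \<and> \<eta> * real N \<le> real (card H)"
      if "good j" for j
    proof -
      have "\<exists>y\<in>layer \<Lambda> j. \<delta> / 2 * real N \<le> level_weight \<Lambda> N (S y)"
      proof (rule ccontr)
        assume "\<not> ?thesis"
        then have "(\<Sum>y\<in>layer \<Lambda> j. level_weight \<Lambda> N (S y)) < (\<Sum>y\<in>layer \<Lambda> j. \<delta> / 2 * real N)"
          using fin pos[of j] by (intro sum_strict_mono) auto
        also have "\<dots> = real (card (layer \<Lambda> j)) * (\<delta> / 2 * real N)" by simp
        also have "\<dots> \<le> real (card (layer \<Lambda> j)) * W j"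
          using that unfolding good_def by (intro mult_left_mono) auto
        finally show False using W_avg by simp
      qed
      then show ?thesis using large[OF N(2)] by blast
    qed
    then obtain Y H where YH: "\<And>j. good j \<Longrightarrow> Y j \<in> layer \<Lambda> j"
      "\<And>j. good j \<Longrightarrow> H j \<in> level_family \<Lambda> N (S (Y j))" "\<And>j. good j \<Longrightarrow> \<eta> * real N \<le> real (card (H j))"
      by metis
    have H_sub: "H j \<subseteq> {..<N}" if "good j" for j
      using YH(2)[OF that] level_family_subset[OF assms(2)] by blast
    \<comment> \<open>The pair \<open>(i, j)\<close> is in \<open>B\<close> if the levels found in
      the section at \<open>Y j\<close> include \<open>i\<close>. A grid in \<open>B\<close> thus
      puts, for each of its second coordinates \<open>j\<close>, a whole progression into a single
      \<open>H j\<close>, and this progression is the same for all of them.\<close>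
    define B where "B = (\<Union>j\<in>{j \<in> {..<N}. good j}. H j \<times> {j})"
    have B: "B \<subseteq> {..<N} \<times> {..<N}" using H_sub by (auto simp: B_def)
    have "\<delta> / 2 * \<eta> * (real N)\<^sup>2 = \<delta> / 2 * real N * (\<eta> * real N)"
      by (simp add: power2_eq_square)
    also have "\<dots> \<le> real (card {j \<in> {..<N}. good j}) * (\<eta> * real N)"
      using good_card \<eta> by (intro mult_right_mono) auto
    also have "\<dots> = (\<Sum>j\<in>{j \<in> {..<N}. good j}. \<eta> * real N)" by simp
    also have "\<dots> \<le> (\<Sum>j\<in>{j \<in> {..<N}. good j}. real (card (H j \<times> {j})))"
      using YH(3) by (intro sum_mono) (auto simp: card_cartesian_product)
    also have "\<dots> = real (card B)"
    proof -
      have "finite (H j)" if "good j" for j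
        using H_sub[OF that] by (rule finite_subset) simp
      then have "card B = (\<Sum>j\<in>{j \<in> {..<N}. good j}. card (H j \<times> {j}))"
        unfolding B_def by (intro card_UN_disjoint) auto
      then show ?thesis by simp
    qed
    finally have "\<exists>q>0. \<exists>c1 c2. \<forall>i\<le>r. \<forall>j\<le>r. (c1 + q * i, c2 + q * j) \<in> B"
      using grid[THEN spec[of _ N]] N(3) B by simp
    then obtain q c1 c2 where q: "q > 0" and
      qB: "\<And>i j. i \<le> r \<Longrightarrow> j \<le> r \<Longrightarrow> (c1 + q * i, c2 + q * j) \<in> B"
      by blast
    define y where "y j = Y (c2 + q * j)" for j
    have good: "good (c2 + q * j)" "c2 + q * j < N" and in_H: "\<And>i. i \<le> r \<Longrightarrow> c1 + q * i \<in> H (c2 + q * j)"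
      if "j \<le> r" for j
      using qB[OF _ that] by (auto simp: B_def)
    have "\<forall>j\<in>{..r}. \<exists>\<phi>. embeds_tree \<Lambda> r q c1 (S (y j)) \<phi>"
      using level_family_embedding[OF assms(2) q YH(2)[OF good(1)] in_H] by (simp add: y_def)
    from bchoice[OF this] obtain \<psi> where
      "\<forall>j\<in>{..r}. embeds_tree \<Lambda> r q c1 (S (y j)) (\<psi> j)" ..
    then have "embeds_tree \<Lambda> r q c1 (S (y j)) (\<psi> j)" if "j \<le> r" for j
      using that by simp
    note \<psi> = embeds_treeD[OF this]
    have y: "y j \<in> lists \<Lambda>" "length (y j) = c2 + q * j" if "j \<le> r" for j
      using YH(1)[OF good(1)[OF that]] by (auto simp: y_def layer_def)
    have y_tree: "y j \<in> tree \<Lambda> N" if "j \<le> r" for j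
      using y[OF that] good(2)[OF that] by (simp add: tree_def)
    have arith: "arithmetic_embedding \<Lambda> r N q (\<psi> j)" if j: "j \<le> r" for j
    proof -
      have "\<psi> j w \<in> tree \<Lambda> N" if w: "w \<in> tree \<Lambda> r" for w
      proof -
        have "c1 + q * length w \<in> H (c2 + q * j)" using in_H[OF j] w by (simp add: tree_def)
        then show ?thesis using \<psi>(3,4)[OF j w] H_sub[OF good(1)[OF j]] by (auto simp: tree_def)
      qed
      moreover have "length (\<psi> j (w @ [a])) = length (\<psi> j w) + q"
        if "w \<in> lists \<Lambda>" "a \<in> \<Lambda>" "length w < r" for w a
      proof -
        have "w \<in> tree \<Lambda> r" "w @ [a] \<in> tree \<Lambda> r" using that by (auto simp: tree_def)
        then show ?thesis using \<psi>(4)[OF j] by simp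
      qed
      ultimately show ?thesis
        unfolding arithmetic_embedding_def regular_embedding_def
        using \<psi>[OF j] by (auto simp: tree_def)
    qed
    define \<Phi> where "\<Phi> = (\<lambda>(u, j). (\<psi> j u, y j))"
    show ?thesis
    proof (rule exI[of _ q], rule conjI[OF q], rule bexI[of _ \<Phi>], rule conjI)
      have "Level (\<Phi> (u, j)) = (q * length u + c1, q * j + c2)" if "u \<in> tree \<Lambda> r" "j \<le> r" for u j
        using \<psi>(4) y that by (simp add: \<Phi>_def Level_def)
      then show "\<exists>c1 c2. \<forall>u \<in> tree \<Lambda> r. \<forall>j \<in> {0..r}.
          Level (\<Phi> (u, j)) = (q * length u + c1, q * j + c2)"
        by (metis atLeastAtMost_iff)
      show "\<forall>j \<in> {0..r}. \<exists>\<phi>j. \<exists>y \<in> tree \<Lambda> N. arithmetic_embedding \<Lambda> r N q \<phi>j \<and>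
          (\<forall>u \<in> tree \<Lambda> r. \<Phi> (u, j) = (\<phi>j u, y))"
      proof
        fix j assume "j \<in> {0..r}"
        then show "\<exists>\<phi>j. \<exists>y \<in> tree \<Lambda> N. arithmetic_embedding \<Lambda> r N q \<phi>j \<and>
            (\<forall>u \<in> tree \<Lambda> r. \<Phi> (u, j) = (\<phi>j u, y))"
          using arith y_tree by (intro exI[of _ "\<psi> j"] bexI[of _ "y j"]) (auto simp: \<Phi>_def)
      qed
      show "\<Phi> \<in> tree \<Lambda> r \<times> {0..r} \<rightarrow> A"
        using \<psi>(2) by (auto simp: \<Phi>_def S_def)
    qed
  qed
  with N show "\<exists>N \<ge> M. N > 0 \<and>
    (\<forall>A. A \<subseteq> tree \<Lambda> N \<times> tree \<Lambda> N \<and> density \<Lambda> N A \<ge> \<delta> \<longrightarrow>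
      (\<exists>q > 0. \<exists>\<phi> \<in> tree \<Lambda> r \<times> {0..r} \<rightarrow> A.
        (\<exists>c1 c2. \<forall>u \<in> tree \<Lambda> r. \<forall>j \<in> {0..r}.
           Level (\<phi> (u, j)) = (q * length u + c1, q * j + c2)) \<and>
        (\<forall>j \<in> {0..r}. \<exists>\<phi>j. \<exists>y \<in> tree \<Lambda> N.
           arithmetic_embedding \<Lambda> r N q \<phi>j \<and>
           (\<forall>u \<in> tree \<Lambda> r. \<phi> (u, j) = (\<phi>j u, y)))))"
    by blast
qed

end
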